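(* Let $\mathfrak{g}$ be a compact semisimple Lie algebra, $\mathfrak{h}$ a Lie subalgebra of $\mathfrak{g}$, and $\phi$ a finite-dimensional faithful complex representation of $\mathfrak{g}$. Then $\mathfrak{h}=\mathfrak{g}$ if and only if $\|(\phi\otimes\bar\phi)|_{\mathfrak{h}}\|_1=\|\phi\otimes\bar\phi\|_1$.
   Context: Representations are finite-dimensional complex matrix representations. $(\phi\otimes\psi)(g)=\phi(g)\otimes\mathbb 1+\mathbb 1\otimes\psi(g)$; the dual is $\bar\phi(g)=-\phi(g)^T$; $|_{\mathfrak{h}}$ denotes restriction. For a semisimple representation $\psi\cong\bigoplus_i\psi_i^{\oplus m_i}$ with pairwise inequivalent irreducible (over $\mathbb C$) $\psi_i$, $\|\psi\|_1=\sum_i m_i$. *)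

theory Defs
  imports "HOL-Analysis.Analysis"
begin

definition lie_algebra :: "('a::euclidean_space \<Rightarrow> 'a \<Rightarrow> 'a) \<Rightarrow> bool" where
  "lie_algebra B \<longleftrightarrow> bilinear B \<and> (\<forall>x. B x x = 0) \<and>
     (\<forall>x y z. B x (B y z) + B y (B z x) + B z (B x y) = 0)"

definition lin_trace :: "('a::euclidean_space \<Rightarrow> 'a) \<Rightarrow> real" where
  "lin_trace f = (\<Sum>b\<in>Basis. f b \<bullet> b)"

definition killing_form :: "('a::euclidean_space \<Rightarrow> 'a \<Rightarrow> 'a) \<Rightarrow> 'a \<Rightarrow> 'a \<Rightarrow> real" where
  "killing_form B x y = lin_trace (\<lambda>z. B x (B y z))"

definition compact_semisimple_lie_algebra :: "('a::euclidean_space \<Rightarrow> 'a \<Rightarrow> 'a) \<Rightarrow> bool" where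
  "compact_semisimple_lie_algebra B \<longleftrightarrow> lie_algebra B \<and>
     (\<forall>x. x \<noteq> 0 \<longrightarrow> killing_form B x x < 0)"

definition lie_subalgebra :: "('a::euclidean_space \<Rightarrow> 'a \<Rightarrow> 'a) \<Rightarrow> 'a set \<Rightarrow> bool" where
  "lie_subalgebra B H \<longleftrightarrow> subspace H \<and> (\<forall>x\<in>H. \<forall>y\<in>H. B x y \<in> H)"

definition commutator :: "complex^'n^'n \<Rightarrow> complex^'n^'n \<Rightarrow> complex^'n^'n" where
  "commutator X Y = X ** Y - Y ** X"

definition mat_cscale :: "complex \<Rightarrow> complex^'n^'m \<Rightarrow> complex^'n^'m" where
  "mat_cscale c X = (\<chi> i j. c * X $ i $ j)"

definition lie_rep :: "('a::euclidean_space \<Rightarrow> 'a \<Rightarrow> 'a) \<Rightarrow> ('a \<Rightarrow> complex^'n^'n) \<Rightarrow> bool" where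
  "lie_rep B \<phi> \<longleftrightarrow>
     (\<forall>x y. \<phi> (x + y) = \<phi> x + \<phi> y) \<and>
     (\<forall>r x. \<phi> (r *\<^sub>R x) = mat_cscale (complex_of_real r) (\<phi> x)) \<and>
     (\<forall>x y. \<phi> (B x y) = commutator (\<phi> x) (\<phi> y))"


definition dual_rep :: "('a \<Rightarrow> complex^'n^'n) \<Rightarrow> 'a \<Rightarrow> complex^'n^'n" where
  "dual_rep \<phi> x = - transpose (\<phi> x)"

definition kron_sum :: "complex^'n^'n \<Rightarrow> complex^'m^'m \<Rightarrow> complex^('n \<times> 'm)^('n \<times> 'm)" where
  "kron_sum A C = (\<chi> p q. A $ fst p $ fst q * (if snd p = snd q then 1 else 0)
                         + (if fst p = fst q then 1 else 0) * C $ snd p $ snd q)"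

definition tensor_rep :: "('a \<Rightarrow> complex^'n^'n) \<Rightarrow> ('a \<Rightarrow> complex^'m^'m) \<Rightarrow> 'a \<Rightarrow> complex^('n \<times> 'm)^('n \<times> 'm)" where
  "tensor_rep \<phi> \<psi> x = kron_sum (\<phi> x) (\<psi> x)"

definition cplx_subspace :: "(complex^'n) set \<Rightarrow> bool" where
  "cplx_subspace V \<longleftrightarrow> 0 \<in> V \<and> (\<forall>u\<in>V. \<forall>v\<in>V. u + v \<in> V) \<and> (\<forall>c. \<forall>v\<in>V. c *s v \<in> V)"

definition rep_invariant :: "('a \<Rightarrow> complex^'n^'n) \<Rightarrow> 'a set \<Rightarrow> (complex^'n) set \<Rightarrow> bool" where
  "rep_invariant \<psi> S V \<longleftrightarrow> cplx_subspace V \<and> (\<forall>x\<in>S. \<forall>v\<in>V. \<psi> x *v v \<in> V)"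

definition rep_irreducible_sub :: "('a \<Rightarrow> complex^'n^'n) \<Rightarrow> 'a set \<Rightarrow> (complex^'n) set \<Rightarrow> bool" where
  "rep_irreducible_sub \<psi> S V \<longleftrightarrow> rep_invariant \<psi> S V \<and> V \<noteq> {0} \<and>
     (\<forall>W. rep_invariant \<psi> S W \<and> W \<subseteq> V \<longrightarrow> W = {0} \<or> W = V)"

definition rep_decomposes :: "('a \<Rightarrow> complex^'n^'n) \<Rightarrow> 'a set \<Rightarrow> nat \<Rightarrow> bool" where
  "rep_decomposes \<psi> S k \<longleftrightarrow> (\<exists>Vs :: nat \<Rightarrow> (complex^'n) set.
     (\<forall>i<k. rep_irreducible_sub \<psi> S (Vs i)) \<and>
     (\<forall>v. \<exists>!w :: nat \<Rightarrow> complex^'n. (\<forall>i<k. w i \<in> Vs i) \<and> (\<forall>i\<ge>k. w i = 0) \<and>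
              v = (\<Sum>i<k. w i)))"

definition rep_norm1 :: "('a \<Rightarrow> complex^'n^'n) \<Rightarrow> 'a set \<Rightarrow> nat" where
  "rep_norm1 \<psi> S = (THE k. rep_decomposes \<psi> S k)"

end

theory Submission
  imports Defs "HOL-Computational_Algebra.Fundamental_Theorem_Algebra"
begin

text \<open>
  No compact group is used. Since \<open>ad x\<close> is skew for the Killing form, the span of the eigenvectors
  of \<open>\<psi> x\<close> with a given real part of the eigenvalue is invariant under \<open>\<gg>\<close>; the trace of
  \<open>\<psi> x\<close> on it vanishes because \<open>\<gg>\<close> is perfect, so all eigenvalues are imaginary. Hence the
  Casimir operator has a trace that is a sum of nonpositive terms on its generalized kernel, and this
  kernel consists of invariants. Applied to \<open>\<psi> \<otimes> \<psi>\<close>-bar, this gives complete reducibility, first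
  over \<open>\<gg>\<close>, whence every \<open>\<psi> x\<close> is diagonalizable, and then over every subalgebra \<open>\<hh>\<close>.

  By the Jordan-Hoelder bound, equality of the two norms means that each \<open>\<gg>\<close>-irreducible summand of
  \<open>\<phi> \<otimes> \<phi>\<close>-bar, which is the space of endomorphisms, stays irreducible over \<open>\<hh>\<close>. Then the Casimir
  operator of \<open>\<hh>\<close> is scalar on the summands, so it commutes with \<open>\<gg>\<close>, and \<open>\<hh>\<close> and \<open>\<gg>\<close> have
  the same invariants. Consequently the tensor \<open>\<Sum> e\<^sub>a \<otimes> e\<^sub>a\<close> of an orthonormal basis of \<open>\<hh>\<close> for the
  trace form of \<open>\<phi>\<close> is \<open>\<gg>\<close>-invariant, which makes \<open>\<hh>\<close> an ideal. Its orthogonal complement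
  commutes with \<open>\<hh>\<close>, therefore with \<open>\<gg>\<close>, and is zero.
\<close>

section \<open>Complex subspaces and matrix arithmetic\<close>

lemma cplx_subspace_iff: "cplx_subspace V \<longleftrightarrow> vec.subspace V"
  by (auto simp: cplx_subspace_def vec.subspace_def)

lemma matrix_add_rdistrib: "((X::complex^'n^'m) + Y) ** A = X ** A + Y ** (A::complex^'k^'n)"
  by (simp add: matrix_matrix_mult_def vec_eq_iff sum.distrib algebra_simps)

lemma matrix_sub_ldistrib: "(A::complex^'n^'m) ** (X - Y) = A ** X - A ** (Y::complex^'k^'n)"
  by (simp add: matrix_matrix_mult_def vec_eq_iff sum_subtractf algebra_simps)

lemma matrix_sub_rdistrib: "((X::complex^'n^'m) - Y) ** A = X ** A - Y ** (A::complex^'k^'n)"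
  by (simp add: matrix_matrix_mult_def vec_eq_iff sum_subtractf algebra_simps)

lemma matrix_sum_ldistrib: "(A::complex^'n^'m) ** (\<Sum>i\<in>I. f i) = (\<Sum>i\<in>I. A ** (f i::complex^'k^'n))"
  by (simp add: matrix_matrix_mult_def vec_eq_iff sum_component sum_distrib_left)
    (auto intro: sum.swap)

lemma matrix_sum_rdistrib: "(\<Sum>i\<in>I. f i::complex^'n^'m) ** A = (\<Sum>i\<in>I. f i ** (A::complex^'k^'n))"
  by (simp add: matrix_matrix_mult_def vec_eq_iff sum_component sum_distrib_right)
    (auto intro: sum.swap)

lemma matrix_vector_sum: "(\<Sum>i\<in>I. f i::complex^'n^'m) *v v = (\<Sum>i\<in>I. f i *v v)"
  by (induction I rule: infinite_finite_induct) (auto simp: matrix_vector_mult_add_rdistrib)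

lemma mat_vector_mult: "mat c *v v = c *s (v::complex^'n)"
  by (simp add: vec_eq_iff matrix_vector_mult_def mat_def if_distrib[of "\<lambda>x. x * _"] cong: if_cong)

lemma trace_mat: "trace (mat c ** A) = c * trace (A::complex^'n^'n)"
  by (simp add: trace_def matrix_matrix_mult_def mat_def if_distrib[of "\<lambda>x. x * _"] sum_distrib_left cong: if_cong)

lemma matrix_vector_smult: "X *v (c *s v) = c *s (X *v (v::complex^'n))"
  by (simp add: vec_eq_iff matrix_vector_mult_def sum_distrib_left ac_simps)

lemma scaleR_matrix_vector: "(r *\<^sub>R X) *v v = of_real r *s (X *v (v::complex^'n))"
  by (simp add: vec_eq_iff matrix_vector_mult_def sum_distrib_left)
    (simp add: scaleR_conv_of_real mult.assoc)

subsection \<open>Eigenvectors in invariant subspaces\<close>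

text \<open>Source and target are separate because the trace lemmas use operators that carry
  \<open>E\<close> into a smaller subspace \<open>F\<close>.\<close>

definition maps_to :: "complex^'n^'n \<Rightarrow> (complex^'n) set \<Rightarrow> (complex^'n) set \<Rightarrow> bool" where
  "maps_to X E F \<longleftrightarrow> (\<forall>v\<in>E. X *v v \<in> F)"

text \<open>Horner evaluation of the vector p(X) v.\<close>

definition poly_apply :: "complex^'n^'n \<Rightarrow> complex poly \<Rightarrow> complex^'n \<Rightarrow> complex^'n" where
  "poly_apply X p v = fold_coeffs (\<lambda>a r. a *s v + X *v r) p 0"

lemma poly_apply_0 [simp]: "poly_apply X 0 v = 0"
  by (simp add: poly_apply_def)

lemma poly_apply_pCons [simp]: "poly_apply X (pCons a p) v = a *s v + X *v poly_apply X p v"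
  by (cases "p = 0 \<and> a = 0") (auto simp: poly_apply_def)

lemma poly_apply_add: "poly_apply X (p + q) v = poly_apply X p v + poly_apply X q v"
  by (induction p q rule: poly_induct2)
    (auto simp: matrix_vector_right_distrib vec.scale_left_distrib)

lemma poly_apply_smult: "poly_apply X (smult c p) v = c *s poly_apply X p v"
  by (induction p) (auto simp: matrix_vector_smult vec.scale_right_distrib)

lemma poly_apply_diff: "poly_apply X (p - q) v = poly_apply X p v - poly_apply X q v"
  by (induction p q rule: poly_induct2)
    (auto simp: matrix_vector_mult_diff_distrib vec.scale_left_diff_distrib)

lemma poly_apply_vector:
  "poly_apply X p (X *v v) = X *v poly_apply X p v"
  "poly_apply X p (v - w) = poly_apply X p v - poly_apply X p w"
  "poly_apply X p (c *s v) = c *s poly_apply X p v"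
  by (induction p) (auto simp: matrix_vector_smult matrix_vector_right_distrib
      matrix_vector_mult_diff_distrib vec.scale_right_diff_distrib vec.scale_right_distrib)

lemma poly_apply_linear_factor:
  "poly_apply X ([:-\<mu>, 1:] * q) v = poly_apply X q (X *v v - \<mu> *s v)"
  by (simp add: poly_apply_diff poly_apply_smult poly_apply_vector poly_apply_add)

text \<open>Split off a root \<open>\<mu>\<close> of \<open>p\<close>: either \<open>v\<close> is
  already an eigenvector for \<open>\<mu>\<close>, or X v - \<mu> v is a nonzero vector of
  \<open>E\<close> killed by a polynomial of smaller degree.\<close>

lemma eigenvector_of_annihilator:
  assumes E: "vec.subspace E" "maps_to X E E"
  shows "p \<noteq> 0 \<Longrightarrow> v \<in> E \<Longrightarrow> v \<noteq> 0 \<Longrightarrow> poly_apply X p v = 0 \<Longrightarrow>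
    \<exists>w\<in>E. w \<noteq> 0 \<and> (\<exists>\<mu>. X *v w = \<mu> *s w)"
proof (induction "degree p" arbitrary: p v)
  case 0
  then show ?case by (auto elim!: degree_eq_zeroE[of p])
next
  case (Suc n)
  then obtain \<mu> where "poly p \<mu> = 0"
    using fundamental_theorem_of_algebra[of p] constant_degree[of p] by auto
  then obtain q where q: "p = [:-\<mu>, 1:] * q"
    by (auto simp: poly_eq_0_iff_dvd)
  let ?w = "X *v v - \<mu> *s v"
  have wE: "?w \<in> E"
    using E Suc.prems by (auto simp: maps_to_def vec.subspace_diff vec.subspace_scale)
  have q0: "q \<noteq> 0" using q Suc.prems by auto
  have dq: "n = degree q"
    using Suc.hyps(2) q q0 by (simp add: degree_mult_eq del: mult_pCons_left)
  have "poly_apply X q ?w = 0"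
    using Suc.prems(4) by (simp add: q poly_apply_linear_factor del: mult_pCons_left)
  then show ?case
    using Suc.hyps(1)[OF dq q0 wE] Suc.prems(2,3) by fastforce
qed

text \<open>The iterates of \<open>v\<close> under \<open>X\<close> cannot all be independent of
  their predecessors in finite dimension, and the first dependence found is a monic annihilating
  polynomial.\<close>

lemma annihilator_exists: "\<exists>p. p \<noteq> 0 \<and> poly_apply X p (v::complex^'n) = 0"
proof -
  define f where "f i = poly_apply X (monom 1 i) v" for i
  \<comment> \<open>\<open>P k\<close> consists of all p(X) v with p of degree below
    \<open>k\<close>; it contains the span of the first \<open>k\<close> iterates.\<close>
  define P where "P k = {poly_apply X p v |p. \<forall>i\<ge>k. coeff p i = 0}" for k :: nat
  have sub: "vec.subspace (P k)" for k
    unfolding vec.subspace_def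
  proof (intro conjI ballI allI)
    show "0 \<in> P k" unfolding P_def by (auto intro!: exI[of _ 0])
    fix x y assume "x \<in> P k" "y \<in> P k"
    then obtain p q where "x = poly_apply X p v" "y = poly_apply X q v"
      "\<forall>i\<ge>k. coeff p i = 0" "\<forall>i\<ge>k. coeff q i = 0" by (auto simp: P_def)
    then show "x + y \<in> P k"
      unfolding P_def by (auto simp: poly_apply_add intro!: exI[of _ "p + q"])
  next
    fix c x assume "x \<in> P k"
    then obtain p where "x = poly_apply X p v" "\<forall>i\<ge>k. coeff p i = 0" by (auto simp: P_def)
    then show "c *s x \<in> P k"
      unfolding P_def by (auto simp: poly_apply_smult intro!: exI[of _ "smult c p"])
  qed
  have span: "vec.span (f ` {..<k}) \<subseteq> P k" for k
    by (rule vec.span_minimal[OF _ sub]) (auto simp: P_def f_def)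
  have "\<exists>k. f k \<in> vec.span (f ` {..<k})"
  proof (rule ccontr)
    assume a: "\<not> ?thesis"
    have "vec.independent (f ` {..<k}) \<and> card (f ` {..<k}) = k" for k
    proof (induction k)
      case 0
      show ?case by (simp add: vec.independent_empty)
    next
      case (Suc k)
      have "f k \<notin> vec.span (f ` {..<k})" using a by blast
      then have "f k \<notin> f ` {..<k}" by (metis vec.span_base)
      then show ?case using Suc \<open>f k \<notin> vec.span _\<close>
        by (simp add: lessThan_Suc vec.independent_insertI)
    qed
    then have "vec.independent (f ` {..<Suc (CARD('n))})" "card (f ` {..<Suc (CARD('n))}) = Suc (CARD('n))"
      by blast+
    then have "Suc (CARD('n)) \<le> vec.dim (UNIV :: (complex^'n) set)"
      using vec.independent_card_le_dim[of "f ` {..<Suc (CARD('n))}" UNIV] by (metis subset_UNIV)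
    then show False unfolding vec_dim_card by simp
  qed
  then obtain k where "f k \<in> P k" using span by blast
  then obtain p where p: "\<forall>i\<ge>k. coeff p i = 0" "f k = poly_apply X p v"
    by (auto simp: P_def)
  have "coeff (monom 1 k - p) k = 1" using p(1) by simp
  then have "monom 1 k - p \<noteq> 0" by (metis coeff_0 zero_neq_one)
  moreover have "poly_apply X (monom 1 k - p) v = 0"
    using p by (simp only: poly_apply_diff p(2)[unfolded f_def, symmetric] diff_self)
  ultimately show ?thesis by blast
qed

lemma eigenvector_exists:
  assumes "vec.subspace E" "maps_to X E E" "E \<noteq> {0}"
  obtains w \<mu> where "w \<in> E" "w \<noteq> 0" "X *v w = \<mu> *s w"
proof -
  obtain v where "v \<in> E" "v \<noteq> 0" using assms vec.subspace_0 by blast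
  moreover obtain p where "p \<noteq> 0" "poly_apply X p v = 0" using annihilator_exists by blast
  ultimately show ?thesis
    using eigenvector_of_annihilator[OF assms(1,2)] that by blast
qed

subsection \<open>Traces on invariant subspaces\<close>

text \<open>An arbitrary linear projection onto \<open>E\<close>, without a preferred complement:
  only its range and its values on \<open>E\<close> matter.\<close>

definition proj_on :: "(complex^'n) set \<Rightarrow> complex^'n^'n" where
  "proj_on E = (SOME P. \<forall>v. P *v v \<in> E \<and> (v \<in> E \<longrightarrow> P *v v = v))"

lemma proj_on:
  assumes "vec.subspace E"
  shows "proj_on E *v v \<in> E" "v \<in> E \<Longrightarrow> proj_on E *v v = v"
proof -
  obtain g where g: "Vector_Spaces.linear (*s) (*s) g" "range g \<subseteq> E" "\<forall>v\<in>E. g v = v"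
    using vec.linear_exists_left_inverse_on[OF vec.linear_id assms] by (auto simp: inj_on_def)
  have "\<forall>v. matrix g *v v \<in> E \<and> (v \<in> E \<longrightarrow> matrix g *v v = v)"
    using g by (auto simp: matrix_works)
  then have "\<forall>v. proj_on E *v v \<in> E \<and> (v \<in> E \<longrightarrow> proj_on E *v v = v)"
    unfolding proj_on_def by (rule someI)
  then show "proj_on E *v v \<in> E" "v \<in> E \<Longrightarrow> proj_on E *v v = v" by auto
qed

lemma matrix_eqI: "(\<And>v. A *v v = C *v v) \<Longrightarrow> A = (C::complex^'n^'m)"
  by (simp add: matrix_eq)

text \<open>For \<open>X\<close> preserving \<open>E\<close>, this is the trace of the restriction
  of \<open>X\<close> to \<open>E\<close>.\<close>

definition subtrace :: "(complex^'n) set \<Rightarrow> complex^'n^'n \<Rightarrow> complex" where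
  "subtrace E X = trace (X ** proj_on E)"

lemma proj_on_absorb:
  assumes "vec.subspace F" "maps_to X E F" "vec.subspace E"
  shows "proj_on F ** (X ** proj_on E) = X ** proj_on E"
  using assms by (intro matrix_eqI)
    (simp add: matrix_vector_mul_assoc[symmetric] proj_on maps_to_def)

lemma subtrace_diff: "subtrace E (X - Y) = subtrace E X - subtrace E Y"
  by (simp add: subtrace_def matrix_sub_rdistrib trace_sub)

lemma subtrace_sum: "subtrace E (\<Sum>i\<in>I. f i) = (\<Sum>i\<in>I. subtrace E (f i))"
  by (induction I rule: infinite_finite_induct)
    (auto simp: subtrace_def matrix_add_rdistrib trace_add, auto simp: trace_def matrix_matrix_mult_def)

lemma subtrace_mat: "subtrace E (mat c ** X) = c * subtrace E X"
  by (simp add: subtrace_def matrix_mul_assoc[symmetric] trace_mat)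

lemma subtrace_singleton_0: "subtrace {0} X = 0"
proof -
  have "proj_on {0} *v v = 0" for v :: "complex^'a" using proj_on(1)[of "{0}"] by auto
  then have "proj_on {0::complex^'a} = 0" by (intro matrix_eqI) simp
  then show ?thesis by (simp add: subtrace_def trace_def matrix_matrix_mult_def)
qed

text \<open>An operator with image in \<open>F\<close> has its whole trace on \<open>F\<close>:
  insert the projection onto \<open>F\<close> on the left, move it to the right by cyclicity, and
  absorb the projection onto \<open>E\<close>.\<close>

lemma subtrace_restrict:
  assumes "vec.subspace E" "vec.subspace F" "F \<subseteq> E" "maps_to X E F"
  shows "subtrace E X = subtrace F X"
proof -
  have "subtrace E X = trace (proj_on F ** (X ** proj_on E))"
    using assms by (simp add: proj_on_absorb subtrace_def)
  also have "\<dots> = trace (X ** (proj_on E ** proj_on F))"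
    by (subst trace_mul_sym) (simp add: matrix_mul_assoc)
  also have "proj_on E ** proj_on F = proj_on F"
    using assms proj_on[of E] proj_on(1)[of F]
    by (intro matrix_eqI) (auto simp: matrix_vector_mul_assoc[symmetric] subset_iff)
  finally show ?thesis by (simp add: subtrace_def)
qed

text \<open>Inserting a second projection between the factors is harmless when the right factor
  preserves \<open>E\<close>, and then cyclicity of the full trace applies.\<close>

lemma subtrace_mult_commute:
  assumes E: "vec.subspace E" and XY: "maps_to X E E" "maps_to Y E E"
  shows "subtrace E (X ** Y) = subtrace E (Y ** X)"
proof -
  have aux: "X ** Y ** proj_on E = (X ** proj_on E) ** (Y ** proj_on E)" if "maps_to Y E E" for X Y
    using that E by (intro matrix_eqI)
      (simp add: matrix_vector_mul_assoc[symmetric] proj_on maps_to_def)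
  show ?thesis
    unfolding subtrace_def aux[OF XY(1)] aux[OF XY(2)] by (rule trace_mul_sym)
qed

text \<open>The trace of a projection is its rank.\<close>

lemma subtrace_id:
  assumes "vec.subspace E"
  shows "subtrace E (mat 1) = of_nat (vec.dim E)"
proof -
  obtain A where A: "A \<subseteq> E" "vec.independent A" "E \<subseteq> vec.span A" "card A = vec.dim E"
    using vec.basis_exists by blast
  have fin: "finite A" using A(2) vec.finiteI_independent by blast
  let ?P = "proj_on E"
  let ?r = "\<lambda>v b. vec.representation A (?P *v v) b"
  have inA: "?P *v v \<in> vec.span A" for v using proj_on(1)[OF assms] A by blast
  have r_sum: "?r (\<Sum>i\<in>I. c i *s f i) b = (\<Sum>i\<in>I. c i * ?r (f i) b)"
    if "finite I" for I :: "'a set" and c f b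
  proof -
    have "?P *v (\<Sum>i\<in>I. c i *s f i) = (\<Sum>i\<in>I. c i *s (?P *v f i))"
      using that by induction (auto simp: matrix_vector_right_distrib matrix_vector_smult)
    then show ?thesis using that inA
      by (simp add: vec.representation_sum[OF A(2)] vec.span_scale vec.representation_scale[OF A(2)])
  qed
  \<comment> \<open>The diagonal entries of the projection are expanded in the basis
    \<open>A\<close>; by linearity, summing over the entries of a basis vector \<open>b\<close>
    gives the \<open>b\<close>-coordinate of its own projection, which is 1.\<close>
  have "subtrace E (mat 1) = (\<Sum>i\<in>UNIV. (?P *v axis i 1) $ i)"
    by (simp only: subtrace_def trace_def matrix_mul_lid)
      (simp add: matrix_vector_mult_def axis_def if_distrib[of "\<lambda>x. _ * x"] cong: if_cong)
  also have "\<dots> = (\<Sum>i\<in>UNIV. (\<Sum>b\<in>A. ?r (axis i 1) b *s b) $ i)"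
    using vec.sum_representation_eq[OF A(2) inA fin] by simp
  also have "\<dots> = (\<Sum>b\<in>A. \<Sum>i\<in>UNIV. b $ i * ?r (axis i 1) b)"
    by (subst sum.swap) (simp add: sum_component mult.commute)
  also have "\<dots> = (\<Sum>b\<in>A. ?r b b)"
    by (rule sum.cong[OF refl], subst r_sum[symmetric]) (simp_all add: basis_expansion)
  also have "\<dots> = (\<Sum>b\<in>A. 1)"
    using A by (intro sum.cong refl)
      (auto simp: proj_on(2)[OF assms] subsetD vec.representation_basis)
  finally show ?thesis using A by simp
qed

text \<open>The last hypothesis says that \<open>X\<close> acts on the quotient of \<open>E\<close>
  by \<open>F\<close> as the scalar \<open>\<mu>\<close>, so the quotient contributes its dimension
  times \<open>\<mu>\<close>, or times the square of \<open>\<mu>\<close> for the squared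
  operator.\<close>

lemma subtrace_split:
  assumes E: "vec.subspace E" "vec.subspace F" "F \<subseteq> E"
    and X: "maps_to X F F" "maps_to (X - mat \<mu>) E F"
  shows "subtrace E X = subtrace F X + \<mu> * of_nat (vec.dim E - vec.dim F)"
    and "subtrace E (X ** X) = subtrace F (X ** X) + \<mu>\<^sup>2 * of_nat (vec.dim E - vec.dim F)"
proof -
  have dim: "of_nat (vec.dim E - vec.dim F) = of_nat (vec.dim E) - (of_nat (vec.dim F)::complex)"
    using vec.dim_subset[OF E(3)] by (simp add: of_nat_diff)
  have c: "subtrace S (mat c) = c * of_nat (vec.dim S)" if "vec.subspace S" for c and S :: "(complex^'a) set"
    using subtrace_mat[of S c "mat 1"] subtrace_id[OF that] by simp
  show "subtrace E X = subtrace F X + \<mu> * of_nat (vec.dim E - vec.dim F)"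
    using subtrace_restrict[OF E X(2)] E by (simp add: subtrace_diff c dim algebra_simps)
  \<comment> \<open>Factor as (X + \<mu>)(X - \<mu>): the right factor sends \<open>E\<close> into
    \<open>F\<close>, and the left one preserves \<open>F\<close>.\<close>
  have "X ** X - mat (\<mu>\<^sup>2) = X ** (X - mat \<mu>) + mat \<mu> ** (X - mat \<mu>)"
    by (rule matrix_eqI) (simp add: matrix_vector_mul_assoc[symmetric] mat_vector_mult algebra_simps
        power2_eq_square matrix_vector_smult)
  then have "maps_to (X ** X - mat (\<mu>\<^sup>2)) E F"
    using X E by (auto simp: maps_to_def matrix_vector_mul_assoc[symmetric] mat_vector_mult
        matrix_vector_mult_add_rdistrib simp del: matrix_vector_mult_diff_rdistrib
        intro!: vec.subspace_add vec.subspace_scale)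
  from subtrace_restrict[OF E this] show
    "subtrace E (X ** X) = subtrace F (X ** X) + \<mu>\<^sup>2 * of_nat (vec.dim E - vec.dim F)"
    using E by (simp add: subtrace_diff c dim algebra_simps)
qed

section \<open>Injectivity, surjectivity and dimension on a subspace\<close>

lemma inj_on_maps_to_surj:
  assumes E: "vec.subspace E" "maps_to X E E" and inj: "\<And>v. v \<in> E \<Longrightarrow> X *v v = 0 \<Longrightarrow> v = 0"
  shows "(*v) X ` E = E"
proof (rule vec.subspace_dim_equal)
  have "inj_on ((*v) X) E"
  proof (rule inj_onI)
    fix v w assume "v \<in> E" "w \<in> E" "X *v v = X *v w"
    then show "v = w" using inj[of "v - w"] E by (auto simp: vec.subspace_diff algebra_simps)
  qed
  then have "inj_on ((*v) X) (vec.span E)" using E(1) by (simp add: vec.span_eq_iff[THEN iffD2])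
  from vec.dim_image_eq[OF _ this] show "vec.dim ((*v) X ` E) \<ge> vec.dim E"
    by (simp add: matrix_vector_mul_linear_gen)
qed (use E in \<open>auto simp: maps_to_def intro!: vec.linear_subspace_image matrix_vector_mul_linear_gen\<close>)

lemma subspace_shift_image:
  assumes "vec.subspace E" shows "vec.subspace ((*v) (X::complex^'n^'n) ` E)"
  by (auto intro!: vec.linear_subspace_image matrix_vector_mul_linear_gen assms)

text \<open>If the image were all of \<open>E\<close>, a right inverse of \<open>X\<close> on
  \<open>E\<close> would be injective and hence map onto \<open>E\<close>. Then \<open>w\<close> is
  a value of it at some \<open>u\<close>, with \<open>u\<close> equal to \<open>X *v w\<close>, so
  both vanish.\<close>

lemma image_dim_less:
  assumes E: "vec.subspace E" "maps_to X E E" and w: "w \<in> E" "w \<noteq> 0" "X *v w = 0"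
  shows "vec.dim ((*v) X ` E) < vec.dim E"
proof (rule ccontr)
  assume a: "\<not> ?thesis"
  have sub: "(*v) X ` E \<subseteq> E" using E by (auto simp: maps_to_def)
  have "(*v) X ` E = E"
    using a E by (intro vec.subspace_dim_equal subspace_shift_image sub) auto
  then have "\<exists>g\<in>{g. range g \<subseteq> E}. Vector_Spaces.linear (*s) (*s) g \<and> (\<forall>v\<in>E. X *v g v = v)"
    using vec.linear_exists_right_inverse_on[OF matrix_vector_mul_linear_gen E(1), of X] by auto
  then obtain g where g: "range g \<subseteq> E" "Vector_Spaces.linear (*s) (*s) g" "\<And>v. v \<in> E \<Longrightarrow> X *v g v = v"
    by auto
  have "(*v) (matrix g) ` E = E"
  proof (rule inj_on_maps_to_surj[OF E(1)])
    show "maps_to (matrix g) E E" using g by (auto simp: maps_to_def matrix_works)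
    show "v = 0" if "v \<in> E" "matrix g *v v = 0" for v
      using g(3)[OF that(1)] that(2) g(2) by (simp add: matrix_works)
  qed
  then obtain u where "u \<in> E" "w = g u" using w(1) g(2) by (auto simp: matrix_works)
  then show False using g w(2,3) vec.linear_0[OF g(2)] by fastforce
qed

text \<open>The trace of the square is the sum of the squared eigenvalues, each a nonpositive real;
  if it vanishes, all eigenvalues are zero and \<open>X\<close> is nilpotent on \<open>E\<close>.
  The induction replaces a triangular form.\<close>

lemma subtrace_square_of_imaginary_eigenvalues:
  assumes "vec.subspace E" "maps_to X E E"
    and "\<And>v \<mu>. v \<in> E \<Longrightarrow> v \<noteq> 0 \<Longrightarrow> X *v v = \<mu> *s v \<Longrightarrow> Re \<mu> = 0"
  shows "\<exists>t\<ge>0. subtrace E (X ** X) = - complex_of_real t \<and>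
    (t = 0 \<longrightarrow> (\<exists>k. \<forall>v\<in>E. ((*v) X ^^ k) v = 0))"
  using assms
proof (induction "vec.dim E" arbitrary: E rule: less_induct)
  case less
  show ?case
  proof (cases "E = {0}")
    case True
    have "subtrace E (X ** X) = 0" by (simp add: True subtrace_singleton_0)
    moreover have "\<forall>v\<in>E. ((*v) X ^^ 0) v = 0" using True by simp
    ultimately show ?thesis by (intro exI[of _ 0]) (metis order_refl of_real_0 minus_zero)
  next
    case False
    then obtain w \<mu> where w: "w \<in> E" "w \<noteq> 0" "X *v w = \<mu> *s w"
      using eigenvector_exists less.prems by metis
    \<comment> \<open>A proper \<open>X\<close>-invariant subspace such that \<open>X\<close> is the
      scalar \<open>\<mu>\<close> on the quotient of \<open>E\<close> by it.\<close>
    define F where "F = (*v) (X - mat \<mu>) ` E"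
    have XE: "maps_to (X - mat \<mu>) E E"
      using less.prems by (auto simp: maps_to_def mat_vector_mult matrix_vector_mult_diff_rdistrib
        intro!: vec.subspace_diff vec.subspace_scale)
    have F: "vec.subspace F" "F \<subseteq> E" "maps_to (X - mat \<mu>) E F"
      using XE less.prems(1) by (auto simp: F_def maps_to_def subspace_shift_image)
    have comm: "X *v ((X - mat \<mu>) *v v) = (X - mat \<mu>) *v (X *v v)" for v
      by (simp add: matrix_vector_mult_diff_rdistrib mat_vector_mult matrix_vector_smult
          matrix_vector_mult_diff_distrib)
    have XF: "maps_to X F F"
      using less.prems(2) by (auto simp: F_def maps_to_def comm)
    have dim: "vec.dim F < vec.dim E"
      unfolding F_def using w XE less.prems(1)
      by (intro image_dim_less[where w=w]) (auto simp: mat_vector_mult matrix_vector_mult_diff_rdistrib)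
    obtain t where t: "t \<ge> 0" "subtrace F (X ** X) = - complex_of_real t"
      "t = 0 \<longrightarrow> (\<exists>k. \<forall>v\<in>F. ((*v) X ^^ k) v = 0)"
      using less.hyps[OF dim F(1) XF] less.prems(3) F(2) by blast
    have re: "Re \<mu> = 0" using less.prems(3) w by blast
    then have mu: "\<mu>\<^sup>2 = - complex_of_real ((Im \<mu>)\<^sup>2)"
      by (simp add: complex_eq_iff power2_eq_square)
    define d where "d = vec.dim E - vec.dim F"
    have d: "real d > 0" using dim by (simp add: d_def)
    define t' where "t' = t + (Im \<mu>)\<^sup>2 * real d"
    have "subtrace E (X ** X) = - complex_of_real t'"
      using subtrace_split(2)[OF less.prems(1) F(1,2) XF F(3)] t(2) mu by (simp add: t'_def d_def)
    moreover have "t' \<ge> 0" using t by (simp add: t'_def)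
    moreover have "\<exists>k. \<forall>v\<in>E. ((*v) X ^^ k) v = 0" if "t' = 0"
    proof -
      have "0 \<le> (Im \<mu>)\<^sup>2 * real d" by simp
      then have t0: "t = 0" "(Im \<mu>)\<^sup>2 * real d = 0" using that t(1) unfolding t'_def by linarith+
      then have mu0: "\<mu> = 0" using d re by (simp add: complex_eq_iff)
      \<comment> \<open>With \<open>\<mu>\<close> zero, \<open>X\<close> maps \<open>E\<close> into
        \<open>F\<close>, so one power more than on \<open>F\<close> kills \<open>E\<close>.\<close>
      obtain k where k: "\<forall>v\<in>F. ((*v) X ^^ k) v = 0" using t(3) t0 by blast
      have "((*v) X ^^ Suc k) v = 0" if "v \<in> E" for v
        using k F(3) that mu0 by (auto simp: funpow_Suc_right maps_to_def mat_vector_mult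
            matrix_vector_mult_diff_rdistrib simp del: funpow.simps)
      then show ?thesis by blast
    qed
    ultimately show ?thesis by blast
  qed
qed

subsection \<open>Lie algebras with an invariant inner product\<close>

text \<open>The locale is instantiated twice: with the negative Killing form, to get the first facts
  about representations, and then with the negative trace form of \<open>\<phi>\<close>, for the
  main argument.\<close>

locale invariant_lie_algebra =
  fixes B :: "'a::euclidean_space \<Rightarrow> 'a \<Rightarrow> 'a" and Q :: "'a \<Rightarrow> 'a \<Rightarrow> real"
  assumes lie: "lie_algebra B"
    and Q_bilinear: "bilinear Q"
    and Q_sym: "Q x y = Q y x"
    and Q_pos: "x \<noteq> 0 \<Longrightarrow> Q x x > 0"
    and Q_inv: "Q (B x y) z = Q x (B y z)"
    and centerless: "(\<And>y. B x y = 0) \<Longrightarrow> x = 0"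
begin

lemma B_bilinear: "bilinear B" and B_self [simp]: "B x x = 0"
  using lie by (auto simp: lie_algebra_def)

lemmas B_simps = bilinear_ladd[OF B_bilinear] bilinear_radd[OF B_bilinear]
  bilinear_lmul[OF B_bilinear] bilinear_rmul[OF B_bilinear] bilinear_lneg[OF B_bilinear]
  bilinear_rneg[OF B_bilinear] bilinear_lsub[OF B_bilinear] bilinear_rsub[OF B_bilinear]
  bilinear_lzero[OF B_bilinear] bilinear_rzero[OF B_bilinear]

lemmas Q_simps = bilinear_ladd[OF Q_bilinear] bilinear_radd[OF Q_bilinear]
  bilinear_lmul[OF Q_bilinear] bilinear_rmul[OF Q_bilinear] bilinear_lneg[OF Q_bilinear]
  bilinear_rneg[OF Q_bilinear] bilinear_lsub[OF Q_bilinear] bilinear_rsub[OF Q_bilinear]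
  bilinear_lzero[OF Q_bilinear] bilinear_rzero[OF Q_bilinear]

lemma B_antisym: "B x y = - B y x"
proof -
  have "B (x + y) (x + y) = B x y + B y x" unfolding B_simps by simp
  then have "B x y + B y x = 0" by simp
  then show ?thesis by (simp add: eq_neg_iff_add_eq_0)
qed

lemma Q_sum: "Q (\<Sum>i\<in>I. f i) y = (\<Sum>i\<in>I. Q (f i) y)" "Q y (\<Sum>i\<in>I. f i) = (\<Sum>i\<in>I. Q y (f i))"
  using Q_bilinear by (auto simp: bilinear_def linear_sum[of "\<lambda>x. Q x y"] linear_sum[of "Q y"])

lemma Q_eq_0_iff: "Q x x = 0 \<longleftrightarrow> x = 0"
  using Q_pos[of x] by (cases "x = 0") (auto simp: Q_simps)

definition Q_basis :: "'a set \<Rightarrow> 'a set \<Rightarrow> bool" where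
  "Q_basis A H \<longleftrightarrow> finite A \<and> A \<subseteq> H \<and> (\<forall>a\<in>A. \<forall>b\<in>A. Q a b = (if a = b then 1 else 0)) \<and>
     (\<forall>v\<in>H. v = (\<Sum>a\<in>A. Q v a *\<^sub>R a))"

text \<open>Gram-Schmidt: normalize one vector and recurse into its orthogonal complement inside
  \<open>H\<close>.\<close>

lemma Q_basis_exists:
  assumes "subspace H" shows "\<exists>A. Q_basis A H"
  using assms
proof (induction "dim H" arbitrary: H rule: less_induct)
  case less
  show ?case
  proof (cases "H \<subseteq> {0}")
    case True
    then have "Q_basis {} H" by (auto simp: Q_basis_def)
    then show ?thesis by blast
  next
    case False
    then obtain u where u: "u \<in> H" "u \<noteq> 0" by auto
    define a where "a = (1 / sqrt (Q u u)) *\<^sub>R u"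
    have a: "a \<in> H" "Q a a = 1"
      using u Q_pos[of u] less.prems by (auto simp: a_def subspace_scale Q_simps field_simps)
    define K where "K = {v\<in>H. Q v a = 0}"
    have K: "subspace K"
      using less.prems by (auto simp: K_def subspace_def Q_simps)
    have "a \<notin> K" using a by (simp add: K_def)
    then have "K \<subset> H" using a(1) unfolding K_def by blast
    then have "dim K < dim H"
      using K less.prems by (metis dim_psubset span_eq_iff)
    from less.hyps[OF this K] obtain A where A: "Q_basis A K" by blast
    have aA: "a \<notin> A" using A a by (auto simp: Q_basis_def K_def)
    have "Q_basis (insert a A) H"
      unfolding Q_basis_def
    proof (intro conjI ballI)
      show "finite (insert a A)" "insert a A \<subseteq> H" using A a by (auto simp: Q_basis_def K_def)
      have z: "Q b a = 0" "Q a b = 0" if "b \<in> A" for b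
        using that A Q_sym[of a b] unfolding Q_basis_def K_def by auto
      show "Q x y = (if x = y then 1 else 0)" if "x \<in> insert a A" "y \<in> insert a A" for x y
        using that A a(2) aA z unfolding Q_basis_def by (metis insert_iff)
      fix v assume v: "v \<in> H"
      have "v - Q v a *\<^sub>R a \<in> K"
        using v a less.prems by (auto simp: K_def subspace_diff subspace_scale Q_simps)
      then have "v - Q v a *\<^sub>R a = (\<Sum>b\<in>A. Q (v - Q v a *\<^sub>R a) b *\<^sub>R b)"
        using A by (auto simp: Q_basis_def)
      also have "\<dots> = (\<Sum>b\<in>A. Q v b *\<^sub>R b)"
        by (rule sum.cong) (auto simp: Q_simps z)
      finally show "v = (\<Sum>b\<in>insert a A. Q v b *\<^sub>R b)"
        using A aA by (simp add: Q_basis_def algebra_simps)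
    qed
    then show ?thesis by blast
  qed
qed

lemma Q_projection:
  assumes "subspace H" obtains h where "h \<in> H" "\<And>w. w \<in> H \<Longrightarrow> Q (v - h) w = 0"
proof -
  obtain A where A: "Q_basis A H" using Q_basis_exists assms by blast
  let ?h = "\<Sum>a\<in>A. Q v a *\<^sub>R a"
  have "Q ?h b = Q v b" if "b \<in> A" for b
  proof -
    have "Q ?h b = (\<Sum>a\<in>A. if a = b then Q v b else 0)"
      unfolding Q_sum using A that by (intro sum.cong) (auto simp: Q_basis_def Q_simps)
    then show ?thesis using A that by (simp add: Q_basis_def)
  qed
  then have *: "Q (v - ?h) b = 0" if "b \<in> A" for b using that by (simp add: Q_simps)
  have "Q (v - ?h) w = 0" if "w \<in> H" for w
  proof -
    have "w = (\<Sum>a\<in>A. Q w a *\<^sub>R a)" using that A by (auto simp: Q_basis_def)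
    then have "Q (v - ?h) w = Q (v - ?h) (\<Sum>a\<in>A. Q w a *\<^sub>R a)" by (rule arg_cong)
    also have "\<dots> = (\<Sum>a\<in>A. Q w a * Q (v - ?h) a)" unfolding Q_sum(2) by (simp add: Q_simps(4))
    finally show ?thesis using * by simp
  qed
  moreover have "?h \<in> H" using A assms by (auto simp: Q_basis_def intro!: subspace_sum subspace_scale)
  ultimately show ?thesis using that by blast
qed

text \<open>A vector r orthogonal to all brackets is central, because Q([r,w],[r,w]) =
  Q(r,[w,[r,w]]) = 0. The membership form makes this an induction principle: a linear condition that
  holds on brackets holds everywhere.\<close>

lemma perfect:
  assumes "subspace K" "\<And>x y. B x y \<in> K" shows "v \<in> K"
proof -
  obtain h where h: "h \<in> K" "\<And>w. w \<in> K \<Longrightarrow> Q (v - h) w = 0" using Q_projection assms(1) by blast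
  have "B (v - h) w = 0" for w
    using h(2)[OF assms(2), of w "B (v - h) w"] Q_inv[of "v - h" w "B (v - h) w"] Q_eq_0_iff by simp
  then show ?thesis using h centerless[of "v - h"] by simp
qed

lemma ad_skew: "Q (B x y) z = - Q y (B x z)"
  using Q_inv[of y x z] B_antisym[of x y] by (simp add: Q_simps)

text \<open>The spectral theorem for the negative semidefinite operator \<open>(ad x)\<^sup>2\<close>, by minimising
  the Rayleigh quotient on the orthogonal complement of the span of the eigenvectors.\<close>

lemma ad_square_diagonalizable:
  "y \<in> span {y. \<exists>\<theta>. B x (B x y) = - (\<theta>\<^sup>2) *\<^sub>R y}" (is "_ \<in> span ?Y")
proof -
  define P where "P = {v. \<forall>w\<in>span ?Y. Q v w = 0}"
  have sub: "subspace P" by (auto simp: P_def subspace_def Q_simps)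
  have "P \<subseteq> {0}"
  proof (rule ccontr)
    assume "\<not> P \<subseteq> {0}"
    then obtain p where p: "p \<in> P" "p \<noteq> 0" by blast
    define q where "q v = Q (B x v) (B x v)" for v
    \<comment> \<open>The Euclidean sphere supplies compactness; the quotient to be minimized is
      invariant under scaling.\<close>
    define K where "K = P \<inter> sphere 0 1"
    have "compact K" unfolding K_def
      using sub by (intro closed_Int_compact closed_subspace compact_sphere)
    moreover have "(1 / norm p) *\<^sub>R p \<in> K" using p sub by (auto simp: K_def subspace_scale)
    moreover have "continuous_on K (\<lambda>v. q v / Q v v)"
    proof -
      have bb: "bounded_bilinear Q" "bounded_bilinear B"
        using Q_bilinear B_bilinear bilinear_conv_bounded_bilinear by blast+
      have "continuous_on K (\<lambda>v. B x v)"
        by (intro bounded_bilinear.continuous_on[OF bb(2)] continuous_intros)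
      then have "continuous_on K q" "continuous_on K (\<lambda>v. Q v v)"
        unfolding q_def by (intro bounded_bilinear.continuous_on[OF bb(1)] continuous_intros; assumption)+
      moreover have "\<forall>v\<in>K. Q v v \<noteq> 0" by (auto simp: K_def Q_eq_0_iff)
      ultimately show ?thesis by (intro continuous_on_divide)
    qed
    ultimately obtain y where y: "y \<in> K" "\<And>v. v \<in> K \<Longrightarrow> q y / Q y y \<le> q v / Q v v"
      using continuous_attains_inf[of K "\<lambda>v. q v / Q v v"] by blast
    define m where "m = q y / Q y y"
    have y0: "y \<noteq> 0" "y \<in> P" using y by (auto simp: K_def)
    have qy: "q y = m * Q y y" using Q_pos[OF y0(1)] by (simp add: m_def)
    have q_nonneg: "q v \<ge> 0" for v
      using Q_pos[of "B x v"] by (cases "B x v = 0") (auto simp: q_def Q_simps)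
    have m0: "m \<ge> 0" unfolding m_def using q_nonneg Q_pos[OF y0(1)] by simp
    have F: "q v - m * Q v v \<ge> 0" if "v \<in> P" for v
    proof (cases "v = 0")
      case True
      then show ?thesis by (simp add: q_def B_simps Q_simps)
    next
      case False
      then have "(1 / norm v) *\<^sub>R v \<in> K" using that sub by (auto simp: K_def subspace_scale)
      from y(2)[OF this] have "m \<le> q v / Q v v"
        using False unfolding m_def q_def by (simp add: B_simps Q_simps field_simps)
      then show ?thesis using Q_pos[OF False] by (simp add: field_simps)
    qed
    \<comment> \<open>First-order condition at the minimum: a nonzero mixed term \<open>b\<close>
      would make the quadratic in \<open>t\<close> negative somewhere.\<close>
    have cross: "Q (B x y) (B x z) - m * Q y z = 0" if "z \<in> P" for z
    proof (rule ccontr)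
      define b where "b = Q (B x y) (B x z) - m * Q y z"
      define c where "c = q z - m * Q z z"
      assume "Q (B x y) (B x z) - m * Q y z \<noteq> 0"
      then have b: "b \<noteq> 0" by (simp add: b_def)
      have c: "c \<ge> 0" using F that by (simp add: c_def)
      have "0 \<le> 2 * t * b + t\<^sup>2 * c" for t
      proof -
        have "y + t *\<^sub>R z \<in> P" using y0 that sub by (simp add: subspace_add subspace_scale)
        from F[OF this] show ?thesis
          using qy Q_sym[of z y] Q_sym[of "B x z" "B x y"]
          by (simp add: q_def b_def c_def B_simps Q_simps power2_eq_square algebra_simps)
      qed
      \<comment> \<open>The \<open>+ 1\<close> keeps the denominator positive when \<open>c\<close>
        is zero.\<close>
      from this[of "- b / (c + 1)"] have "0 \<le> - 2 * b\<^sup>2 / (c + 1) + b\<^sup>2 * c / (c + 1)\<^sup>2"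
        by (simp add: power_divide power2_eq_square)
      also have "\<dots> = (- 2 * b\<^sup>2 * (c + 1) + b\<^sup>2 * c) / (c + 1)\<^sup>2"
        using c by (simp add: divide_simps) (simp add: power2_eq_square algebra_simps)
      also have "\<dots> = - (b\<^sup>2 * (c + 2)) / (c + 1)\<^sup>2" by (simp add: algebra_simps)
      also have "\<dots> < 0" using b c by (intro divide_neg_pos) (auto intro!: mult_pos_pos)
      finally show False by simp
    qed
    have inv: "B x (B x w) \<in> span ?Y" if "w \<in> span ?Y" for w
      using that
    proof (induction rule: span_induct)
      case base
      show ?case by (auto simp: B_simps intro!: subspaceI span_add span_scale span_zero)
    next
      case (step w)
      then obtain \<theta> where "B x (B x w) = - (\<theta>\<^sup>2) *\<^sub>R w" by blast
      with step show ?case by (simp only: span_scale span_base)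
    qed
    \<comment> \<open>This vector is orthogonal to \<open>P\<close>; it also lies in
      \<open>P\<close>, since the span is stable under the square of ad x. So it vanishes.\<close>
    have *: "Q (B x (B x y) + m *\<^sub>R y) z = 0" if "z \<in> P" for z
      using cross[OF that] by (simp add: Q_simps ad_skew[of x "B x y"])
    have "B x (B x y) + m *\<^sub>R y \<in> P"
      using y0 inv unfolding P_def by (simp add: Q_simps ad_skew[of x])
    from *[OF this] have "B x (B x y) + m *\<^sub>R y = 0" by (simp only: Q_eq_0_iff)
    then have "B x (B x y) = - ((sqrt m)\<^sup>2) *\<^sub>R y" using m0 by (simp add: eq_neg_iff_add_eq_0)
    then have "y \<in> span ?Y" by (intro span_base) blast
    then have "Q y y = 0" using y0(2) unfolding P_def by blast
    then show False using y0(1) by (simp add: Q_eq_0_iff)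
  qed
  moreover obtain h where h: "h \<in> span ?Y" "\<And>w. w \<in> span ?Y \<Longrightarrow> Q (y - h) w = 0"
    using Q_projection[OF subspace_span] by blast
  ultimately have "y - h = 0" by (simp only: P_def subset_iff) blast
  then show ?thesis using h(1) by simp
qed

end

subsection \<open>Representations and their eigenvalues\<close>

lemma lie_rep_linear: assumes "lie_rep B \<psi>" shows "linear \<psi>"
proof (rule linearI)
  show "\<psi> (x + y) = \<psi> x + \<psi> y" for x y using assms by (simp add: lie_rep_def)
  show "\<psi> (r *\<^sub>R x) = r *\<^sub>R \<psi> x" for r x
    using assms by (simp add: lie_rep_def mat_cscale_def vec_eq_iff scaleR_conv_of_real[symmetric])
qed

lemma lie_rep_simps:
  assumes "lie_rep B \<psi>"
  shows "\<psi> (x + y) = \<psi> x + \<psi> y" "\<psi> (x - y) = \<psi> x - \<psi> y" "\<psi> (r *\<^sub>R x) = r *\<^sub>R \<psi> x"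
    "\<psi> (- x) = - \<psi> x" "\<psi> 0 = 0" "\<psi> (B x y) = \<psi> x ** \<psi> y - \<psi> y ** \<psi> x"
    "\<psi> (\<Sum>i\<in>I. f i) = (\<Sum>i\<in>I. \<psi> (f i))"
  using lie_rep_linear[OF assms] assms
  by (auto simp: linear_add linear_diff linear_scale linear_neg linear_0 lie_rep_def
      commutator_def linear_sum)

lemma lie_rep_vector:
  assumes "lie_rep B \<psi>"
  shows "\<psi> x *v (\<psi> y *v v) = \<psi> y *v (\<psi> x *v v) + \<psi> (B x y) *v v"
  by (simp add: lie_rep_simps(6)[OF assms] matrix_vector_mul_assoc matrix_vector_mult_diff_rdistrib)

lemma uminus_matrix_vector: "(- X) *v v = - (X *v (v::complex^'n))"
  by (simp add: matrix_vector_mult_def vec_eq_iff sum_negf)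

text \<open>This allows mapping properties to be extended linearly from a spanning set, or from
  brackets by \<open>perfect\<close>.\<close>

lemma lie_rep_subspace_preserving:
  assumes rep: "lie_rep B \<psi>" and "vec.subspace E" "vec.subspace F"
  shows "subspace {y. maps_to (\<psi> y) E F}"
  using assms(2,3)
  by (auto simp: subspace_def maps_to_def lie_rep_simps[OF rep] matrix_vector_mult_add_rdistrib
      scaleR_matrix_vector vec.subspace_0 vec.subspace_add vec.subspace_scale)

context invariant_lie_algebra
begin

lemma ad_square_eq_0: assumes "B x (B x y) = 0" shows "B x y = 0"
  using ad_skew[of x y "B x y"] assms by (simp add: Q_simps Q_eq_0_iff)

context
  fixes \<psi> :: "'a \<Rightarrow> complex^'n^'n"
  assumes rep: "lie_rep B \<psi>"
begin

text \<open>If \<open>[x, [x, y]] = - \<theta>\<^sup>2 y\<close>, then \<open>y \<mp> (\<i> / \<theta>) [x, y]\<close> are complex root vectors of \<open>x\<close> with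
  roots \<open>\<plusminus> \<i> \<theta>\<close>.\<close>

lemma root_vector:
  fixes v :: "complex^'n" and x y :: 'a
  assumes "B x (B x y) = - (\<theta>\<^sup>2) *\<^sub>R y" "c * c = - 1" "\<theta> \<noteq> 0"
  defines "Z \<equiv> \<lambda>v. \<psi> y *v v - (c / of_real \<theta>) *s (\<psi> (B x y) *v v)"
  shows "\<psi> x *v Z v = Z (\<psi> x *v v) + (c * of_real \<theta>) *s Z v"
proof -
  have p: "\<psi> x *v (\<psi> y *v v) = \<psi> y *v (\<psi> x *v v) + \<psi> (B x y) *v v"
    by (rule lie_rep_vector[OF rep])
  have q: "\<psi> x *v (\<psi> (B x y) *v v) = \<psi> (B x y) *v (\<psi> x *v v) - of_real (\<theta>\<^sup>2) *s (\<psi> y *v v)"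
    using lie_rep_vector[OF rep, of x "B x y" v]
    by (simp add: assms(1) lie_rep_simps[OF rep] scaleR_matrix_vector uminus_matrix_vector)
  have 1: "c / of_real \<theta> * of_real (\<theta>\<^sup>2) = c * of_real \<theta>"
    using assms(3) by (simp add: power2_eq_square)
  have 2: "c * of_real \<theta> * (c / of_real \<theta>) = - 1"
    using assms(2,3) by (simp add: field_simps)
  show ?thesis
    unfolding Z_def matrix_vector_mult_diff_distrib matrix_vector_smult p q
      vec.scale_right_diff_distrib vec.scale_scale 1 2 by simp
qed

lemma rep_invariant_by_ad:
  assumes E: "vec.subspace U"
    and *: "\<And>y \<theta>. B x (B x y) = - (\<theta>\<^sup>2) *\<^sub>R y \<Longrightarrow> maps_to (\<psi> y) U U"
  shows "maps_to (\<psi> y) U U"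
proof -
  have "span {y. \<exists>\<theta>. B x (B x y) = - (\<theta>\<^sup>2) *\<^sub>R y} \<subseteq> {y. maps_to (\<psi> y) U U}"
    by (rule span_minimal[OF _ lie_rep_subspace_preserving[OF rep E E]]) (use * in blast)
  then show ?thesis using ad_square_diagonalizable[of y x] by blast
qed

text \<open>Root vectors of \<open>x\<close> shift its eigenvalues by imaginary amounts, so a set
  \<open>L\<close> closed under such shifts yields an invariant span. It is applied to the numbers
  of a fixed real part and to all complex numbers.\<close>

lemma eigenvector_span_invariant:
  fixes x :: 'a
  assumes L: "\<And>\<mu> t. \<mu> \<in> L \<Longrightarrow> \<mu> + \<i> * complex_of_real t \<in> L"
  defines "U \<equiv> vec.span {v. \<exists>\<mu>\<in>L. \<psi> x *v v = \<mu> *s v}"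
  shows "maps_to (\<psi> y) U U"
proof (rule rep_invariant_by_ad)
  show U: "vec.subspace U" by (simp add: U_def)
  fix y \<theta> assume y: "B x (B x y) = - (\<theta>\<^sup>2) *\<^sub>R y"
  have "\<psi> y *v v \<in> U" if v: "\<mu> \<in> L" "\<psi> x *v v = \<mu> *s v" for \<mu> v
  \<comment> \<open>For \<open>\<theta>\<close> zero, skewness forces \<open>B x y = 0\<close> and
    \<open>\<psi> y\<close> preserves the eigenspace; otherwise \<open>\<psi> y *v v\<close> is half
    the sum of two shifted eigenvectors (or zero vectors).\<close>
  proof (cases "\<theta> = 0")
    case True
    then have "B x y = 0" using y ad_square_eq_0 by simp
    then have "\<psi> x *v (\<psi> y *v v) = \<mu> *s (\<psi> y *v v)"
      using lie_rep_vector[OF rep, of x y v] v(2) by (simp add: lie_rep_simps[OF rep] matrix_vector_smult)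
    then show ?thesis unfolding U_def using v(1) by (intro vec.span_base) blast
  next
    case False
    define Z where "Z c = \<psi> y *v v - (c / of_real \<theta>) *s (\<psi> (B x y) *v v)" for c
    have Z: "Z c \<in> U" if "c * c = - 1" "\<mu> + c * of_real \<theta> \<in> L" for c
    proof -
      have "\<psi> x *v Z c = (\<mu> + c * of_real \<theta>) *s Z c"
        unfolding Z_def root_vector[OF y that(1) False]
        by (simp add: v(2) matrix_vector_smult vec_eq_iff algebra_simps)
      then show ?thesis unfolding U_def using that by (intro vec.span_base) blast
    qed
    have "Z \<i> \<in> U" "Z (- \<i>) \<in> U"
      using L[OF v(1), of \<theta>] L[OF v(1), of "- \<theta>"] by (auto intro!: Z)
    moreover have "\<psi> y *v v = (1 / 2) *s (Z \<i> + Z (- \<i>))"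
      by (simp add: Z_def vec_eq_iff)
    ultimately show ?thesis using U by (simp only: vec.subspace_scale vec.subspace_add)
  qed
  then show "maps_to (\<psi> y) U U"
    unfolding maps_to_def
  proof (intro ballI)
    fix v assume "v \<in> U"
    then show "\<psi> y *v v \<in> U" unfolding U_def
    proof (induction rule: vec.span_induct)
      case base
      show ?case by (auto simp: vec.subspace_def matrix_vector_right_distrib matrix_vector_smult
            vec.span_add vec.span_scale vec.span_zero)
    qed (use \<open>\<And>\<mu> v. \<lbrakk>\<mu> \<in> L; \<psi> x *v v = \<mu> *s v\<rbrakk> \<Longrightarrow> \<psi> y *v v \<in> U\<close> U_def in blast)
  qed
qed

text \<open>A bracket acts on \<open>U\<close> as a commutator, which has trace zero, and brackets
  span the algebra.\<close>

lemma subtrace_eq_0: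
  assumes "vec.subspace U" "\<And>y. maps_to (\<psi> y) U U"
  shows "subtrace U (\<psi> x) = 0"
proof -
  have "x \<in> {x. subtrace U (\<psi> x) = 0}"
  proof (rule perfect)
    have r: "subtrace U (r *\<^sub>R X) = of_real r * subtrace U X" for r and X :: "complex^'n^'n"
      by (simp add: subtrace_def trace_def matrix_matrix_mult_def sum_distrib_left)
        (simp add: scaleR_conv_of_real mult.assoc)
    have a: "subtrace U (X + Y) = subtrace U X + subtrace U Y" for X Y :: "complex^'n^'n"
      by (simp add: subtrace_def matrix_add_rdistrib trace_add)
    show "subspace {x. subtrace U (\<psi> x) = 0}"
      using subtrace_diff[of U 0 0] by (simp add: subspace_def lie_rep_simps[OF rep] a r)
    show "B x y \<in> {x. subtrace U (\<psi> x) = 0}" for x y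
      using subtrace_mult_commute[OF assms(1) assms(2) assms(2)]
      by (simp add: lie_rep_simps[OF rep] subtrace_diff)
  qed
  then show ?thesis by simp
qed

end

end

text \<open>Each eigenvector outside the span of the others raises the dimension by one and the
  trace by its eigenvalue. The eigenvalues may differ in their imaginary parts.\<close>

lemma Re_subtrace_span_eigenvectors:
  assumes "finite A" "\<And>a. a \<in> A \<Longrightarrow> \<exists>\<mu>. Re \<mu> = r \<and> X *v a = \<mu> *s a"
  shows "Re (subtrace (vec.span A) X) = r * vec.dim (vec.span A)"
  using assms
proof induction
  case empty
  show ?case by (simp add: subtrace_singleton_0)
next
  case (insert a A)
  show ?case
  proof (cases "a \<in> vec.span A")
    case True
    then show ?thesis using insert by (simp add: vec.span_redundant)
  next
    case False
    obtain \<mu> where mu: "Re \<mu> = r" "X *v a = \<mu> *s a" using insert.prems by blast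
    have inv: "maps_to X (vec.span A) (vec.span A)"
      unfolding maps_to_def
    proof
      fix v assume "v \<in> vec.span A"
      then show "X *v v \<in> vec.span A"
      proof (induction rule: vec.span_induct)
        case base
        show ?case by (auto simp: vec.subspace_def matrix_vector_right_distrib matrix_vector_smult
            vec.span_add vec.span_scale vec.span_zero)
      next
        case (step v)
        then obtain \<nu> where "X *v v = \<nu> *s v" using insert.prems by blast
        then show ?case using step by (simp add: vec.span_base vec.span_scale)
      qed
    qed
    have "maps_to (X - mat \<mu>) (vec.span (insert a A)) (vec.span A)"
      unfolding maps_to_def
    proof
      fix v assume "v \<in> vec.span (insert a A)"
      then obtain k where k: "v - k *s a \<in> vec.span A" using vec.span_breakdown_eq by blast
      define u where "u = v - k *s a"
      have v: "v = u + k *s a" by (simp add: u_def)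
      have "(X - mat \<mu>) *v v = X *v u - \<mu> *s u"
        by (simp add: v mu matrix_vector_mult_diff_rdistrib mat_vector_mult matrix_vector_right_distrib
            matrix_vector_smult vec.scale_right_distrib mult.commute)
      moreover have "u \<in> vec.span A" using k by (simp add: u_def)
      ultimately show "(X - mat \<mu>) *v v \<in> vec.span A"
        using inv by (auto simp: maps_to_def intro!: vec.span_diff vec.span_scale)
    qed
    from subtrace_split(1)[OF _ _ _ inv this]
    have "subtrace (vec.span (insert a A)) X = subtrace (vec.span A) X
        + \<mu> * of_nat (vec.dim (vec.span (insert a A)) - vec.dim (vec.span A))"
      by (simp add: vec.span_mono subset_insertI)
    then show ?thesis
      using insert mu False by (simp add: vec.dim_insert algebra_simps)
  qed
qed

context invariant_lie_algebra
begin

text \<open>The invariant span of the eigenvectors with real part \<open>r\<close> has trace zero,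
  but the real part of that trace is \<open>r\<close> times a nonzero dimension.\<close>

lemma rep_eigenvalue_imaginary:
  fixes v :: "complex^'n"
  assumes rep: "lie_rep B \<psi>" and v: "\<psi> x *v v = \<mu> *s v" "v \<noteq> 0"
  shows "Re \<mu> = 0"
proof -
  define r where "r = Re \<mu>"
  define Y where "Y = {v. \<exists>\<mu>\<in>{\<mu>. Re \<mu> = r}. \<psi> x *v v = \<mu> *s v}"
  have inv: "maps_to (\<psi> y) (vec.span Y) (vec.span Y)" for y
    unfolding Y_def by (rule eigenvector_span_invariant[OF rep]) simp
  obtain A where A: "A \<subseteq> Y" "vec.independent A" "Y \<subseteq> vec.span A"
    using vec.maximal_independent_subset by blast
  have span: "vec.span A = vec.span Y" using A by (metis vec.span_mono vec.span_span subset_antisym)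
  have "Re (subtrace (vec.span A) (\<psi> x)) = r * vec.dim (vec.span A)"
    using A vec.finiteI_independent by (intro Re_subtrace_span_eigenvectors) (auto simp: Y_def)
  then have "r * vec.dim (vec.span Y) = 0"
    using subtrace_eq_0[OF rep _ inv] by (simp add: span)
  moreover have "v \<in> vec.span Y" by (rule vec.span_base) (use v in \<open>auto simp: Y_def r_def\<close>)
  then have "vec.dim (vec.span Y) \<noteq> 0" using v(2) vec.dim_eq_0[of "vec.span Y"] by blast
  ultimately show ?thesis by (simp add: r_def)
qed

end

subsection \<open>Casimir operators\<close>

text \<open>For a \<open>Q\<close>-orthonormal basis \<open>A\<close> the dual basis is
  \<open>A\<close> itself, so the Casimir operator is a sum of squares.\<close>

definition casimir :: "('a \<Rightarrow> complex^'n^'n) \<Rightarrow> 'a set \<Rightarrow> complex^'n^'n" where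
  "casimir \<psi> A = (\<Sum>a\<in>A. \<psi> a ** \<psi> a)"

lemma casimir_vector: "casimir \<psi> A *v v = (\<Sum>a\<in>A. \<psi> a *v (\<psi> a *v v))"
  by (simp add: casimir_def matrix_vector_sum matrix_vector_mul_assoc)

lemma scaleR_matrix_mult:
  "(r *\<^sub>R X) ** Y = r *\<^sub>R (X ** (Y::complex^'n^'n))" "X ** (r *\<^sub>R Y) = r *\<^sub>R ((X::complex^'n^'n) ** Y)"
  by (simp_all add: matrix_matrix_mult_def vec_eq_iff scaleR_sum_right)

text \<open>By induction on the power of \<open>X\<close> killing \<open>v\<close>, Z kills X v.
  Then Z v satisfies the eigenvalue equation of \<open>X\<close> for \<open>\<alpha>\<close>, which
  is nonzero, so nilpotency of \<open>X\<close> makes Z v vanish.\<close>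

lemma nilpotent_root_vector:
  fixes X Z :: "complex^'n^'n"
  assumes "\<And>v. v \<in> E \<Longrightarrow> X *v v \<in> E \<and> Z *v v \<in> E \<and> ((*v) X ^^ m) v = 0"
    and "\<And>v. v \<in> E \<Longrightarrow> X *v (Z *v v) = Z *v (X *v v) + \<alpha> *s (Z *v v)" "\<alpha> \<noteq> 0"
  shows "v \<in> E \<Longrightarrow> Z *v v = 0"
proof -
  have "v \<in> E \<Longrightarrow> ((*v) X ^^ k) v = 0 \<Longrightarrow> Z *v v = 0" for k
  proof (induction k arbitrary: v)
    case (Suc k)
    have "Z *v (X *v v) = 0"
      using Suc assms(1) by (simp add: funpow_Suc_right del: funpow.simps)
    then have e: "X *v (Z *v v) = \<alpha> *s (Z *v v)" using assms(2) Suc.prems by simp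
    have "((*v) X ^^ n) (Z *v v) = \<alpha> ^ n *s (Z *v v)" for n
      by (induction n) (auto simp: matrix_vector_smult e mult.commute)
    then show ?case using assms(1,3) Suc.prems(1) by (metis power_not_zero vec.scale_eq_0_iff)
  qed simp
  then show "v \<in> E \<Longrightarrow> Z *v v = 0" using assms(1) by blast
qed

context invariant_lie_algebra
begin

text \<open>The matrix \<open>M\<close> of ad x in an orthonormal basis is skew, so the two sums
  produced by the commutator cancel.\<close>

lemma casimir_commute:
  fixes \<psi> :: "'a \<Rightarrow> complex^'n^'n"
  assumes rep: "lie_rep B \<psi>" and A: "Q_basis A H" and H: "lie_subalgebra B H" and x: "x \<in> H"
  shows "\<psi> x ** casimir \<psi> A = casimir \<psi> A ** \<psi> x"
proof -
  define M where "M a b = Q (B x a) b" for a b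
  have M: "\<psi> (B x a) = (\<Sum>b\<in>A. M a b *\<^sub>R \<psi> b)" if "a \<in> A" for a
  proof -
    have "B x a \<in> H" using H x A that by (auto simp: lie_subalgebra_def Q_basis_def)
    then have "B x a = (\<Sum>b\<in>A. M a b *\<^sub>R b)" using A unfolding Q_basis_def M_def by blast
    then have "\<psi> (B x a) = \<psi> (\<Sum>b\<in>A. M a b *\<^sub>R b)" by (rule arg_cong)
    then show ?thesis by (simp add: lie_rep_simps[OF rep])
  qed
  have skew: "M b a = - M a b" for a b
    unfolding M_def using ad_skew[of x b a] Q_sym[of b "B x a"] by simp
  have "(\<Sum>a\<in>A. \<psi> a ** \<psi> (B x a)) = (\<Sum>a\<in>A. \<Sum>b\<in>A. M a b *\<^sub>R (\<psi> a ** \<psi> b))"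
    by (intro sum.cong refl) (simp only: M matrix_sum_ldistrib scaleR_matrix_mult)
  also have "\<dots> = (\<Sum>b\<in>A. \<Sum>a\<in>A. M a b *\<^sub>R (\<psi> a ** \<psi> b))" by (rule sum.swap)
  also have "\<dots> = (\<Sum>b\<in>A. \<Sum>a\<in>A. - (M b a *\<^sub>R (\<psi> a ** \<psi> b)))"
    by (intro sum.cong refl) (subst skew, simp)
  also have "\<dots> = - (\<Sum>b\<in>A. \<psi> (B x b) ** \<psi> b)"
    unfolding sum_negf
    by (intro arg_cong[of _ _ uminus] sum.cong refl)
      (simp only: M matrix_sum_rdistrib scaleR_matrix_mult)
  finally have z: "(\<Sum>a\<in>A. \<psi> a ** \<psi> (B x a)) + (\<Sum>a\<in>A. \<psi> (B x a) ** \<psi> a) = 0" by simp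
  have "\<psi> x ** (\<psi> a ** \<psi> a) = \<psi> a ** \<psi> a ** \<psi> x + (\<psi> a ** \<psi> (B x a) + \<psi> (B x a) ** \<psi> a)" for a
    by (simp add: lie_rep_simps(6)[OF rep] matrix_sub_ldistrib matrix_sub_rdistrib matrix_mul_assoc)
  then have "\<psi> x ** casimir \<psi> A = (\<Sum>a\<in>A. \<psi> a ** \<psi> a ** \<psi> x) +
      ((\<Sum>a\<in>A. \<psi> a ** \<psi> (B x a)) + (\<Sum>a\<in>A. \<psi> (B x a) ** \<psi> a))"
    by (simp add: casimir_def matrix_sum_ldistrib sum.distrib)
  then show ?thesis by (simp add: z casimir_def matrix_sum_rdistrib)
qed

context
  fixes \<psi> :: "'a \<Rightarrow> complex^'n^'n" and A H
  assumes rep: "lie_rep B \<psi>" and A: "Q_basis A H" and H: "lie_subalgebra B H"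
begin

private abbreviation "C \<equiv> casimir \<psi> A"
text \<open>The second kernel of \<open>C\<close>. Showing that it consists of invariants makes
  \<open>C\<close> injective on its own image, which is what the splitting argument for complete
  reducibility uses.\<close>

private definition "E = {v. C *v (C *v v) = 0}"

private lemma E_subspace: "vec.subspace E"
  by (auto simp: E_def vec.subspace_def matrix_vector_right_distrib matrix_vector_smult)

private lemma E_invariant: assumes "x \<in> H" shows "maps_to (\<psi> x) E E"
proof -
  have "C *v (\<psi> x *v v) = \<psi> x *v (C *v v)" for v
    using casimir_commute[OF rep A H assms] by (simp add: matrix_vector_mul_assoc)
  then show ?thesis by (auto simp: E_def maps_to_def)
qed

private lemma nilpotent_on_E:
  assumes a: "a \<in> A" shows "\<exists>k. \<forall>v\<in>E. ((*v) (\<psi> a) ^^ k) v = 0"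
proof -
  have fin: "finite A" and AH: "A \<subseteq> H" using A by (auto simp: Q_basis_def)
  define F where "F = {v. C *v v = 0}"
  have F: "vec.subspace F" "F \<subseteq> E"
    by (auto simp: E_def F_def vec.subspace_def matrix_vector_right_distrib matrix_vector_smult)
  \<comment> \<open>\<open>C\<close> maps \<open>E\<close> into its kernel \<open>F\<close> and
    \<open>F\<close> to zero, so two restrictions show that its trace on \<open>E\<close> vanishes.
    This trace is a sum of nonpositive terms, one for each basis element, so every term is
    zero.\<close>
  have "subtrace E C = subtrace F C"
    by (rule subtrace_restrict[OF E_subspace F]) (auto simp: E_def F_def maps_to_def)
  also have "\<dots> = subtrace {0} C"
    by (rule subtrace_restrict[OF F(1)]) (auto simp: F_def maps_to_def)
  finally have "(\<Sum>a\<in>A. subtrace E (\<psi> a ** \<psi> a)) = 0"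
    by (simp add: subtrace_singleton_0 casimir_def subtrace_sum)
  moreover have "\<exists>t\<ge>0. subtrace E (\<psi> a ** \<psi> a) = - complex_of_real t \<and>
    (t = 0 \<longrightarrow> (\<exists>k. \<forall>v\<in>E. ((*v) (\<psi> a) ^^ k) v = 0))" if "a \<in> A" for a
  proof (rule subtrace_square_of_imaginary_eigenvalues[OF E_subspace E_invariant])
    show "a \<in> H" using that AH by (rule rev_subsetD)
    show "Re \<mu> = 0" if "v \<noteq> 0" "\<psi> a *v v = \<mu> *s v" for v \<mu>
      using rep_eigenvalue_imaginary[OF rep that(2,1)] .
  qed
  then obtain t where t: "\<And>a. a \<in> A \<Longrightarrow> t a \<ge> 0 \<and> subtrace E (\<psi> a ** \<psi> a) = - complex_of_real (t a) \<and>
    (t a = 0 \<longrightarrow> (\<exists>k. \<forall>v\<in>E. ((*v) (\<psi> a) ^^ k) v = 0))" by metis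
  ultimately have "complex_of_real (\<Sum>a\<in>A. t a) = 0" by (simp add: sum_negf)
  then have "(\<Sum>a\<in>A. t a) = 0" by (simp only: of_real_eq_0_iff)
  then have "t a = 0" using t fin a by (simp add: sum_nonneg_eq_0_iff)
  then show ?thesis using t a by blast
qed

private lemma span_A: assumes "subspace K" "A \<subseteq> K" shows "H \<subseteq> K"
proof
  fix x assume "x \<in> H"
  then have "x = (\<Sum>a\<in>A. Q x a *\<^sub>R a)" using A by (auto simp: Q_basis_def)
  moreover have "(\<Sum>a\<in>A. Q x a *\<^sub>R a) \<in> K"
    using assms by (intro subspace_sum subspace_scale) auto
  ultimately show "x \<in> K" by simp
qed

private lemma K_subspace: "subspace {y. maps_to (\<psi> y) E {0}}"
  by (rule lie_rep_subspace_preserving[OF rep E_subspace]) simp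

text \<open>Diagonalizability of \<open>\<psi> x\<close> is not yet available here. Instead,
  nilpotency of \<open>\<psi> a\<close> on \<open>E\<close> kills its root vectors, so all brackets
  with \<open>a\<close> act as zero on \<open>E\<close>, and perfectness does the rest.\<close>

lemma casimir_square_kernel_UNIV:
  assumes "H = UNIV" and v: "casimir \<psi> A *v (casimir \<psi> A *v v) = 0"
  shows "\<psi> x *v v = 0"
proof -
  have *: "maps_to (\<psi> (B a y)) E {0}" if "a \<in> A" for a y
  proof -
    obtain k where k: "\<forall>v\<in>E. ((*v) (\<psi> a) ^^ k) v = 0" using nilpotent_on_E \<open>a \<in> A\<close> by blast
    have sub: "subspace {y. maps_to (\<psi> (B a y)) E {0}}"
      using K_subspace by (auto simp: subspace_def B_simps)
    have "{y. \<exists>\<theta>. B a (B a y) = - (\<theta>\<^sup>2) *\<^sub>R y} \<subseteq> {y. maps_to (\<psi> (B a y)) E {0}}"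
    proof safe
      fix y \<theta> assume y: "B a (B a y) = - (\<theta>\<^sup>2) *\<^sub>R y"
      show "maps_to (\<psi> (B a y)) E {0}"
      proof (cases "\<theta> = 0")
        case True
        then have "B a y = 0" using y ad_square_eq_0 by simp
        then show ?thesis by (simp add: maps_to_def lie_rep_simps[OF rep])
      next
        case False
        define Z where "Z c = \<psi> y - mat (c / of_real \<theta>) ** \<psi> (B a y)" for c
        have Zv: "Z c *v v = \<psi> y *v v - (c / of_real \<theta>) *s (\<psi> (B a y) *v v)" for c v
          by (simp add: Z_def matrix_vector_mult_diff_rdistrib matrix_vector_mul_assoc[symmetric] mat_vector_mult)
        have inv: "maps_to (\<psi> x) E E" for x using E_invariant assms(1) by simp
        have "Z c *v v = 0" if "c * c = - 1" "v \<in> E" for c v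
        proof (rule nilpotent_root_vector[of E "\<psi> a" _ k "c * of_real \<theta>"])
          show "\<psi> a *v v \<in> E \<and> Z c *v v \<in> E \<and> ((*v) (\<psi> a) ^^ k) v = 0" if "v \<in> E" for v
            using that inv k E_subspace
            by (auto simp: Zv maps_to_def intro!: vec.subspace_diff vec.subspace_scale)
          show "\<psi> a *v (Z c *v v) = Z c *v (\<psi> a *v v) + (c * of_real \<theta>) *s (Z c *v v)" for v
            unfolding Zv by (rule root_vector[OF rep y that(1) False])
          show "c * of_real \<theta> \<noteq> 0" using that False by auto
        qed (rule that)
        then have Z0: "Z \<i> *v v = 0" "Z (- \<i>) *v v = 0" if "v \<in> E" for v using that by simp_all
        have "\<psi> (B a y) *v v = 0" if "v \<in> E" for v
        proof -
          \<comment> \<open>The difference of the two opposite root vectors isolates the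
            bracket.\<close>
          have "(2 * \<i> / of_real \<theta>) *s (\<psi> (B a y) *v v) = Z (- \<i>) *v v - Z \<i> *v v"
            by (simp add: Zv vec_eq_iff)
          also have "\<dots> = 0" using Z0[OF that] by simp
          finally show ?thesis using False by (simp only: vec.scale_eq_0_iff) simp
        qed
        then show ?thesis by (simp add: maps_to_def)
      qed
    qed
    then have "span {y. \<exists>\<theta>. B a (B a y) = - (\<theta>\<^sup>2) *\<^sub>R y} \<subseteq> {y. maps_to (\<psi> (B a y)) E {0}}"
      using sub by (rule span_minimal)
    from subsetD[OF this ad_square_diagonalizable] show ?thesis by simp
  qed
  \<comment> \<open>The condition is linear in the first argument of the bracket, so it passes from
    \<open>A\<close> to the whole algebra.\<close>
  have "subspace {x. maps_to (\<psi> (B x y)) E {0}}" for y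
    using K_subspace by (auto simp: subspace_def B_simps)
  then have "subspace (\<Inter>y. {x. maps_to (\<psi> (B x y)) E {0}})" by (intro subspace_Inter) blast
  then have sub: "subspace {x. \<forall>y. maps_to (\<psi> (B x y)) E {0}}"
    by (simp only: Collect_all_eq)
  have "A \<subseteq> {x. \<forall>y. maps_to (\<psi> (B x y)) E {0}}" using * by (simp add: subset_iff)
  from span_A[OF sub this] have "maps_to (\<psi> (B x y)) E {0}" for x y
    using assms(1) by auto
  then have "B x y \<in> {y. maps_to (\<psi> y) E {0}}" for x y by simp
  from perfect[OF K_subspace this] have "maps_to (\<psi> x) E {0}" by simp
  then have "\<forall>v\<in>E. \<psi> x *v v = 0" by (simp add: maps_to_def)
  moreover have "v \<in> E" using v by (simp only: E_def mem_Collect_eq)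
  ultimately show ?thesis by (rule bspec)
qed

text \<open>The hypothesis \<open>good\<close> excludes nontrivial nilpotent blocks, so nilpotency
  of each \<open>\<psi> a\<close> on \<open>E\<close> already means that it is zero there. No
  perfectness of \<open>H\<close> enters.\<close>

lemma casimir_square_kernel:
  assumes good: "\<And>x v. \<psi> x *v (\<psi> x *v v) = 0 \<Longrightarrow> \<psi> x *v v = 0"
    and x: "x \<in> H" and v: "casimir \<psi> A *v (casimir \<psi> A *v v) = 0"
  shows "\<psi> x *v v = 0"
proof -
  have "maps_to (\<psi> a) E {0}" if "a \<in> A" for a
  proof -
    have red: "((*v) (\<psi> a) ^^ Suc k) v = 0 \<Longrightarrow> \<psi> a *v v = 0" for k v
    proof (induction k)
      case (Suc k)
      have "\<psi> a *v (\<psi> a *v ((*v) (\<psi> a) ^^ k) v) = 0" using Suc.prems by simp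
      from good[OF this] show ?case by (intro Suc.IH) simp
    qed simp
    obtain k where k: "\<forall>v\<in>E. ((*v) (\<psi> a) ^^ k) v = 0" using nilpotent_on_E \<open>a \<in> A\<close> by blast
    have "\<psi> a *v v = 0" if "v \<in> E" for v
      by (rule red[of k]) (simp add: k that)
    then show ?thesis by (simp add: maps_to_def)
  qed
  then have "A \<subseteq> {y. maps_to (\<psi> y) E {0}}" by (simp add: subset_iff)
  from subsetD[OF span_A[OF K_subspace this] x] have "\<forall>v\<in>E. \<psi> x *v v = 0" by (simp add: maps_to_def)
  moreover have "v \<in> E" using v by (simp only: E_def mem_Collect_eq)
  ultimately show ?thesis by (rule bspec)
qed

end

end

subsection \<open>Complete reducibility\<close>

text \<open>Identifies endomorphisms with vectors of the tensor product, so that the tensor product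
  with the dual acts on matrices.\<close>

definition mvec :: "complex^'n^'n \<Rightarrow> complex^('n \<times> 'n)" where
  "mvec X = (\<chi> p. X $ fst p $ snd p)"

lemma mvec_surj: obtains X where "m = mvec X"
proof
  show "m = mvec (\<chi> i j. m $ (i, j))" by (simp add: mvec_def vec_eq_iff)
qed

lemma mvec_inject [simp]: "mvec X = mvec Y \<longleftrightarrow> X = Y"
  by (auto simp: mvec_def vec_eq_iff)

lemma mvec_simps:
  "mvec (X + Y) = mvec X + mvec Y" "mvec (X - Y) = mvec X - mvec Y" "mvec 0 = 0"
  "mvec (mat c ** X) = c *s mvec X"
  by (auto simp: mvec_def vec_eq_iff matrix_matrix_mult_def mat_def if_distrib[of "\<lambda>x. x * _"] cong: if_cong)

lemma sum_prod_UNIV: "(\<Sum>p\<in>UNIV. f p) = (\<Sum>i\<in>UNIV. \<Sum>j\<in>UNIV. f (i, j))"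
  by (simp add: sum.cartesian_product)

text \<open>The action on endomorphisms is by commutators, so the invariants are exactly the
  matrices commuting with the representation.\<close>

lemma tensor_dual_mvec:
  "tensor_rep \<psi> (dual_rep \<psi>) x *v mvec X = mvec (\<psi> x ** X - X ** \<psi> x)"
proof -
  let ?A = "\<psi> x"
  have "(tensor_rep \<psi> (dual_rep \<psi>) x *v mvec X) $ (a, b) = (?A ** X - X ** ?A) $ a $ b" for a b
  proof -
    have "(tensor_rep \<psi> (dual_rep \<psi>) x *v mvec X) $ (a, b) = (\<Sum>i\<in>UNIV. \<Sum>j\<in>UNIV.
        (?A $ a $ i * (if b = j then 1 else 0) + (if a = i then 1 else 0) * - ?A $ j $ b) * X $ i $ j)"
      by (simp add: mvec_def tensor_rep_def kron_sum_def dual_rep_def transpose_def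
          matrix_vector_mult_def sum_prod_UNIV)
    also have "\<dots> = (\<Sum>i\<in>UNIV. \<Sum>j\<in>UNIV. if b = j then ?A $ a $ i * X $ i $ j else 0)
        + (\<Sum>i\<in>UNIV. \<Sum>j\<in>UNIV. if a = i then - (X $ i $ j * ?A $ j $ b) else 0)"
      unfolding sum.distrib[symmetric] by (intro sum.cong refl) (auto simp: algebra_simps)
    also have "(\<Sum>i\<in>UNIV. \<Sum>j\<in>UNIV. if a = i then - (X $ i $ j * ?A $ j $ b) else 0) =
        (\<Sum>j\<in>UNIV. \<Sum>i\<in>UNIV. if a = i then - (X $ i $ j * ?A $ j $ b) else 0)"
      by (rule sum.swap)
    finally show ?thesis by (simp add: matrix_matrix_mult_def sum_negf)
  qed
  then show ?thesis by (simp add: vec_eq_iff mvec_def)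
qed

lemma lie_rep_tensor_dual:
  fixes \<psi> :: "'a::euclidean_space \<Rightarrow> complex^'n^'n"
  assumes "lie_rep B \<psi>" shows "lie_rep B (tensor_rep \<psi> (dual_rep \<psi>))" (is "lie_rep B ?P")
  unfolding lie_rep_def
proof (intro conjI allI)
  note s = lie_rep_simps[OF assms]
  show "?P (x + y) = ?P x + ?P y" for x y
    by (simp add: tensor_rep_def kron_sum_def dual_rep_def s transpose_def vec_eq_iff algebra_simps)
  show "?P (r *\<^sub>R x) = mat_cscale (of_real r) (?P x)" for r x
    by (simp add: tensor_rep_def kron_sum_def dual_rep_def s transpose_def vec_eq_iff mat_cscale_def
        scaleR_conv_of_real[where 'a=complex] distrib_left right_diff_distrib)
  show "?P (B x y) = commutator (?P x) (?P y)" for x y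
  proof (rule matrix_eqI)
    fix m :: "complex^('n \<times> 'n)"
    obtain X where X: "m = mvec X" by (rule mvec_surj)
    show "?P (B x y) *v m = commutator (?P x) (?P y) *v m"
      unfolding X commutator_def matrix_vector_mult_diff_rdistrib matrix_vector_mul_assoc[symmetric]
        tensor_dual_mvec mvec_simps(2)[symmetric] s(6)
      by (simp add: matrix_sub_ldistrib matrix_sub_rdistrib matrix_mul_assoc)
  qed
qed

definition completely_reducible :: "('a \<Rightarrow> complex^'n^'n) \<Rightarrow> 'a set \<Rightarrow> bool" where
  "completely_reducible \<psi> S \<longleftrightarrow> (\<forall>W. rep_invariant \<psi> S W \<longrightarrow>
     (\<exists>U. rep_invariant \<psi> S U \<and> W \<inter> U = {0} \<and> (\<forall>v. \<exists>w\<in>W. v - w \<in> U)))"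

lemma completely_reducibleE:
  assumes "completely_reducible \<psi> S" "rep_invariant \<psi> S W"
  obtains U where "rep_invariant \<psi> S U" "W \<inter> U = {0}" "\<And>v. \<exists>w\<in>W. v - w \<in> U"
  using assms unfolding completely_reducible_def by meson

lemma rep_invariant_iff: "rep_invariant \<psi> S V \<longleftrightarrow> vec.subspace V \<and> (\<forall>x\<in>S. maps_to (\<psi> x) V V)"
  by (auto simp: rep_invariant_def cplx_subspace_iff maps_to_def)

text \<open>A linear projection onto \<open>W\<close> is corrected, inside the maps with image in \<open>W\<close> that are scalar on
  \<open>W\<close>, by an element of the image of the Casimir operator so as to commute with the representation.\<close>

lemma completely_reducibleI:
  fixes \<psi> :: "'a::euclidean_space \<Rightarrow> complex^'n^'n"
  defines "\<Psi> \<equiv> tensor_rep \<psi> (dual_rep \<psi>)"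
  assumes A: "A \<subseteq> S"
    and core: "\<And>x v. x \<in> S \<Longrightarrow> casimir \<Psi> A *v (casimir \<Psi> A *v v) = 0 \<Longrightarrow> \<Psi> x *v v = 0"
  shows "completely_reducible \<psi> S"
  unfolding completely_reducible_def
proof (intro allI impI)
  fix W assume "rep_invariant \<psi> S W"
  then have W: "vec.subspace W" "\<And>x v. x \<in> S \<Longrightarrow> v \<in> W \<Longrightarrow> \<psi> x *v v \<in> W"
    by (auto simp: rep_invariant_iff maps_to_def)
  define C where "C = casimir \<Psi> A"
  \<comment> \<open>\<open>V\<close> collects the operators with image in \<open>W\<close> that are
    scalar on \<open>W\<close>, and \<open>V0\<close> those with scalar zero; the representation
    maps \<open>V\<close> into \<open>V0\<close>.\<close>
  define V0 where "V0 = {mvec X |X. (\<forall>v. X *v v \<in> W) \<and> (\<forall>w\<in>W. X *v w = 0)}"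
  define V where "V = {mvec X |X. (\<forall>v. X *v v \<in> W) \<and> (\<exists>c. \<forall>w\<in>W. X *v w = c *s w)}"
  have V0I: "mvec X \<in> V0" if "\<And>v. X *v v \<in> W" "\<And>w. w \<in> W \<Longrightarrow> X *v w = 0" for X
    using that by (auto simp: V0_def)
  have VI: "mvec X \<in> V" if "\<And>v. X *v v \<in> W" "\<And>w. w \<in> W \<Longrightarrow> X *v w = c *s w" for X c
    using that by (auto simp: V_def)
  have V0V: "V0 \<subseteq> V" by (auto simp: V0_def intro!: VI[where c=0])
  have subV0: "vec.subspace V0"
    unfolding vec.subspace_def
  proof (intro conjI ballI allI)
    show "0 \<in> V0" using V0I[of 0] W(1) by (simp add: mvec_simps vec.subspace_0)
    show "x + y \<in> V0" if "x \<in> V0" "y \<in> V0" for x y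
      using that W(1) by (auto simp: V0_def mvec_simps(1)[symmetric] matrix_vector_mult_add_rdistrib vec.subspace_add)
    show "c *s x \<in> V0" if "x \<in> V0" for c x
      using that W(1) by (auto simp: V0_def mvec_simps(4)[symmetric] matrix_vector_mul_assoc[symmetric]
          mat_vector_mult vec.subspace_scale)
  qed
  have subV: "vec.subspace V"
    unfolding vec.subspace_def
  proof (intro conjI ballI allI)
    show "0 \<in> V" using subV0 V0V vec.subspace_0 by blast
    show "x + y \<in> V" if xy: "x \<in> V" "y \<in> V" for x y
    proof -
      obtain X c Y d where X: "x = mvec X" "\<And>v. X *v v \<in> W" "\<And>w. w \<in> W \<Longrightarrow> X *v w = c *s w"
        and Y: "y = mvec Y" "\<And>v. Y *v v \<in> W" "\<And>w. w \<in> W \<Longrightarrow> Y *v w = d *s w"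
        using xy unfolding V_def by blast
      show ?thesis unfolding X(1) Y(1) mvec_simps(1)[symmetric]
        using X Y W(1) by (intro VI[where c="c + d"])
          (simp_all add: matrix_vector_mult_add_rdistrib vec.subspace_add vec.scale_left_distrib)
    qed
    show "c *s x \<in> V" if x: "x \<in> V" for c x
    proof -
      obtain X d where X: "x = mvec X" "\<And>v. X *v v \<in> W" "\<And>w. w \<in> W \<Longrightarrow> X *v w = d *s w"
        using x unfolding V_def by blast
      show ?thesis unfolding X(1) mvec_simps(4)[symmetric]
        using X W(1) by (intro VI[where c="c * d"])
          (simp_all add: matrix_vector_mul_assoc[symmetric] mat_vector_mult vec.subspace_scale)
    qed
  qed
  have \<Psi>V: "\<Psi> x *v m \<in> V0" if "x \<in> S" "m \<in> V" for x m
  proof -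
    obtain X c where X: "m = mvec X" "\<And>v. X *v v \<in> W" "\<And>w. w \<in> W \<Longrightarrow> X *v w = c *s w"
      using \<open>m \<in> V\<close> unfolding V_def by blast
    show ?thesis
      unfolding X(1) \<Psi>_def tensor_dual_mvec
      using X W that(1)
      by (intro V0I) (simp_all add: matrix_vector_mult_diff_rdistrib matrix_vector_mul_assoc[symmetric]
          vec.subspace_diff matrix_vector_smult)
  qed
  have CV: "C *v m \<in> V0" if "m \<in> V" for m
    unfolding C_def casimir_vector using A V0V \<Psi>V that by (intro vec.subspace_sum subV0) blast
  \<comment> \<open>\<open>C\<close> is injective on its image \<open>I\<close>: by
    \<open>core\<close>, its second kernel consists of invariants, and these are killed by
    \<open>C\<close>. Hence \<open>C\<close> maps \<open>I\<close> onto itself.\<close>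
  define I where "I = (*v) C ` V"
  have I: "vec.subspace I" "I \<subseteq> V0" using subspace_shift_image[OF subV] CV by (auto simp: I_def)
  have "(*v) C ` I = I"
  proof (rule inj_on_maps_to_surj[OF I(1)])
    show "maps_to C I I" using I(2) V0V by (auto simp: maps_to_def I_def)
    fix u assume "u \<in> I" "C *v u = 0"
    then obtain m where m: "u = C *v m" "C *v (C *v m) = 0" by (auto simp: I_def)
    have "\<Psi> a *v m = 0" if "a \<in> A" for a using core[of a m] m(2) that A by (auto simp: C_def)
    then show "u = 0" unfolding m(1) C_def casimir_vector by simp
  qed
  moreover have P0: "mvec (proj_on W) \<in> V"
    by (rule VI[where c=1]) (simp_all add: proj_on W(1))
  ultimately obtain u where u: "u \<in> I" "C *v u = C *v mvec (proj_on W)" by (metis I_def imageE imageI)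
  then obtain Y where Y: "u = mvec Y" "\<And>v. Y *v v \<in> W" "\<And>w. w \<in> W \<Longrightarrow> Y *v w = 0"
    using I(2) by (auto simp: V0_def)
  \<comment> \<open>\<open>Y\<close> vanishes on \<open>W\<close>, so \<open>P\<close> is still a
    projection onto \<open>W\<close>; the choice of \<open>u\<close> makes \<open>C\<close> kill
    \<open>P\<close>, so \<open>P\<close> is invariant.\<close>
  define P where "P = proj_on W - Y"
  have P: "P *v v \<in> W" "w \<in> W \<Longrightarrow> P *v w = w" for v w
    using Y W(1) by (simp_all add: P_def matrix_vector_mult_diff_rdistrib proj_on vec.subspace_diff)
  have "C *v (C *v mvec P) = 0"
    by (simp add: P_def mvec_simps Y(1)[symmetric] matrix_vector_mult_diff_distrib u(2))
  then have "\<Psi> x *v mvec P = 0" if "x \<in> S" for x using core that by (simp add: C_def)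
  then have comm: "\<psi> x ** P = P ** \<psi> x" if "x \<in> S" for x
    using that by (simp add: \<Psi>_def tensor_dual_mvec mvec_simps(3)[symmetric] del: mvec_simps(3))
  define U where "U = {v. P *v v = 0}"
  have "rep_invariant \<psi> S U"
    unfolding rep_invariant_iff
  proof (intro conjI ballI)
    show "vec.subspace U"
      by (auto simp: U_def vec.subspace_def matrix_vector_right_distrib matrix_vector_smult)
    show "maps_to (\<psi> x) U U" if "x \<in> S" for x
    proof -
      have "P *v (\<psi> x *v v) = \<psi> x *v (P *v v)" for v
        by (simp only: matrix_vector_mul_assoc comm[OF that])
      then show ?thesis by (simp add: U_def maps_to_def)
    qed
  qed
  moreover have "W \<inter> U = {0}" using P(2) W(1) by (force simp: U_def vec.subspace_0)
  moreover have "\<exists>w\<in>W. v - w \<in> U" for v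
    using P by (intro bexI[of _ "P *v v"]) (auto simp: U_def matrix_vector_mult_diff_distrib)
  ultimately show "\<exists>U. rep_invariant \<psi> S U \<and> W \<inter> U = {0} \<and> (\<forall>v. \<exists>w\<in>W. v - w \<in> U)" by blast
qed

context invariant_lie_algebra
begin

lemma completely_reducible_UNIV:
  assumes "lie_rep B \<psi>" shows "completely_reducible \<psi> UNIV"
proof -
  obtain A where A: "Q_basis A UNIV" using Q_basis_exists subspace_UNIV by blast
  have "lie_subalgebra B UNIV" by (simp add: lie_subalgebra_def)
  then show ?thesis
    using casimir_square_kernel_UNIV[OF lie_rep_tensor_dual[OF assms] A]
    by (intro completely_reducibleI[of A]) auto
qed

text \<open>The span of all eigenvectors of \<open>\<psi> x\<close> is invariant, and an invariant
  complement contains no eigenvector, so it is zero. Thus \<open>\<psi> x\<close> is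
  diagonalizable.\<close>

lemma rep_kernel_square:
  assumes rep: "lie_rep B \<psi>" and "\<psi> x *v (\<psi> x *v v) = 0"
  shows "\<psi> x *v v = 0"
proof -
  define X where "X = \<psi> x"
  define Y where "Y = {v. \<exists>\<mu>\<in>UNIV. X *v v = \<mu> *s v}"
  have "rep_invariant \<psi> UNIV (vec.span Y)"
    unfolding rep_invariant_iff Y_def X_def using eigenvector_span_invariant[OF rep, of UNIV] by simp
  then obtain U where U: "rep_invariant \<psi> UNIV U" "vec.span Y \<inter> U = {0}"
    "\<And>v. \<exists>w\<in>vec.span Y. v - w \<in> U"
    by (rule completely_reducibleE[OF completely_reducible_UNIV[OF rep]]) blast
  have "U = {0}"
  proof (rule ccontr)
    assume "U \<noteq> {0}"
    moreover have "vec.subspace U" "maps_to X U U" using U(1) by (auto simp: rep_invariant_iff X_def)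
    ultimately obtain w \<mu> where w: "w \<in> U" "w \<noteq> 0" "X *v w = \<mu> *s w"
      using eigenvector_exists by metis
    then have "w \<in> vec.span Y" by (intro vec.span_base) (auto simp: Y_def)
    then show False using U(2) w by blast
  qed
  then have Y: "v \<in> vec.span Y" for v using U(3)[of v] by auto
  \<comment> \<open>Since eigenvectors span, \<open>X\<close> maps its image \<open>R\<close> onto
    \<open>R\<close>; a nonzero vector of \<open>R\<close> killed by \<open>X\<close> would lower
    the dimension.\<close>
  define R where "R = (*v) X ` UNIV"
  have R: "vec.subspace R" "maps_to X R R" "vec.subspace ((*v) X ` R)"
    by (auto simp: R_def maps_to_def intro!: subspace_shift_image)
  have "X *v v \<in> (*v) X ` R" for v
    using Y[of v]
  proof (induction rule: vec.span_induct)
    case base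
    show ?case using R(3) by (auto simp: vec.subspace_def matrix_vector_right_distrib matrix_vector_smult)
  next
    case (step v)
    then obtain \<mu> where mu: "X *v v = \<mu> *s v" by (auto simp: Y_def)
    show ?case
    proof (cases "\<mu> = 0")
      case True
      then show ?thesis using mu R(3) by (simp add: vec.subspace_0)
    next
      case False
      then have "X *v v = X *v (X *v ((1 / \<mu>) *s v))" using mu by (simp add: matrix_vector_smult)
      then show ?thesis by (auto simp: R_def)
    qed
  qed
  then have "R \<subseteq> (*v) X ` R" by (auto simp: R_def)
  then have "vec.dim R \<le> vec.dim ((*v) X ` R)" by (rule vec.dim_subset)
  moreover have "X *v v \<in> R" by (simp add: R_def)
  ultimately have "X *v v = 0"
    using image_dim_less[OF R(1,2), of "X *v v"] assms(2) by (auto simp: X_def)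
  then show ?thesis by (simp add: X_def)
qed

text \<open>\<open>H\<close> may be abelian, so perfectness cannot be applied to it;
  diagonalizability over the full algebra of the action on endomorphisms takes its place.\<close>

lemma completely_reducible_subalgebra:
  assumes rep: "lie_rep B \<psi>" and H: "lie_subalgebra B H"
  shows "completely_reducible \<psi> H"
proof -
  obtain A where A: "Q_basis A H" using Q_basis_exists[of H] H unfolding lie_subalgebra_def by blast
  note rep' = lie_rep_tensor_dual[OF rep]
  show ?thesis
    using A casimir_square_kernel[OF rep' A H rep_kernel_square[OF rep']]
    by (intro completely_reducibleI[of A]) (auto simp: Q_basis_def)
qed

end

subsection \<open>Decompositions into irreducible subspaces\<close>

definition partial_sum :: "(nat \<Rightarrow> (complex^'n) set) \<Rightarrow> nat \<Rightarrow> (complex^'n) set" where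
  "partial_sum Vs k = {\<Sum>i<k. w i |w. \<forall>i<k. w i \<in> Vs i}"

lemma partial_sum_0 [simp]: "partial_sum Vs 0 = {0}"
  by (simp add: partial_sum_def)

lemma partial_sum_Suc:
  "v \<in> partial_sum Vs (Suc k) \<longleftrightarrow> (\<exists>x\<in>partial_sum Vs k. \<exists>y\<in>Vs k. v = x + y)"
proof
  assume "v \<in> partial_sum Vs (Suc k)"
  then obtain w where w: "\<forall>i<Suc k. w i \<in> Vs i" "v = (\<Sum>i<k. w i) + w k"
    by (auto simp: partial_sum_def)
  then show "\<exists>x\<in>partial_sum Vs k. \<exists>y\<in>Vs k. v = x + y"
    by (intro bexI[of _ "\<Sum>i<k. w i"] bexI[of _ "w k"]) (auto simp: partial_sum_def)
next
  assume "\<exists>x\<in>partial_sum Vs k. \<exists>y\<in>Vs k. v = x + y"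
  then obtain w y where w: "\<forall>i<k. w i \<in> Vs i" "y \<in> Vs k" "v = (\<Sum>i<k. w i) + y"
    by (auto simp: partial_sum_def)
  have "v = (\<Sum>i<Suc k. (w(k := y)) i)" using w(3) by simp
  moreover have "\<forall>i<Suc k. (w(k := y)) i \<in> Vs i" using w by (simp add: less_Suc_eq)
  ultimately show "v \<in> partial_sum Vs (Suc k)" unfolding partial_sum_def by blast
qed

lemma partial_sum_cong:
  assumes "\<And>i. i < k \<Longrightarrow> Vs i = Ws i" shows "partial_sum Vs k = partial_sum Ws k"
  using assms by (simp add: partial_sum_def)

lemma rep_invariant_plus:
  assumes "rep_invariant \<psi> S U" "rep_invariant \<psi> S V"
  shows "rep_invariant \<psi> S {x + y |x y. x \<in> U \<and> y \<in> V}"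
  unfolding rep_invariant_iff
proof (intro conjI ballI)
  show "vec.subspace {x + y |x y. x \<in> U \<and> y \<in> V}"
    using assms by (intro vec.subspace_sums) (auto simp: rep_invariant_iff)
  show "maps_to (\<psi> x) {x + y |x y. x \<in> U \<and> y \<in> V} {x + y |x y. x \<in> U \<and> y \<in> V}" if "x \<in> S" for x
    unfolding maps_to_def
  proof
    fix v assume "v \<in> {x + y |x y. x \<in> U \<and> y \<in> V}"
    then obtain u u' where u: "v = u + u'" "u \<in> U" "u' \<in> V" by blast
    then have "\<psi> x *v u \<in> U" "\<psi> x *v u' \<in> V"
      using assms that by (auto simp: rep_invariant_def)
    then show "\<psi> x *v v \<in> {x + y |x y. x \<in> U \<and> y \<in> V}"
      unfolding u(1) matrix_vector_right_distrib by blast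
  qed
qed

lemma rep_invariant_partial_sum:
  assumes "\<And>i. i < k \<Longrightarrow> rep_invariant \<psi> S (Vs i)"
  shows "rep_invariant \<psi> S (partial_sum Vs k)"
  using assms
proof (induction k)
  case 0
  then show ?case by (auto simp: rep_invariant_def cplx_subspace_def)
next
  case (Suc k)
  have "partial_sum Vs (Suc k) = {x + y |x y. x \<in> partial_sum Vs k \<and> y \<in> Vs k}"
    using partial_sum_Suc by blast
  then show ?case using Suc by (simp add: rep_invariant_plus)
qed

lemma rep_invariant_mono: "rep_invariant \<psi> S V \<Longrightarrow> T \<subseteq> S \<Longrightarrow> rep_invariant \<psi> T V"
  by (auto simp: rep_invariant_def)

lemma rep_invariant_0: "rep_invariant \<psi> S V \<Longrightarrow> 0 \<in> V"
  by (auto simp: rep_invariant_def cplx_subspace_def)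

lemma rep_invariant_diff: "rep_invariant \<psi> S V \<Longrightarrow> x \<in> V \<Longrightarrow> y \<in> V \<Longrightarrow> x - y \<in> V"
  by (auto simp: rep_invariant_iff vec.subspace_diff)

lemma rep_irreducible_subD:
  assumes "rep_irreducible_sub \<psi> S V"
  shows "rep_invariant \<psi> S V" "V \<noteq> {0}" "rep_invariant \<psi> S W \<Longrightarrow> W \<subseteq> V \<Longrightarrow> W = {0} \<or> W = V"
  using assms by (auto simp: rep_irreducible_sub_def)

text \<open>Every weakly increasing chain of invariant subspaces makes at most \<open>k\<close> steps inside a sum of
  \<open>k\<close> irreducible subspaces (the length bound of the Jordan-Hoelder theorem). A step that is visible in
  the sum of the first \<open>k + 1\<close> subspaces but not in the sum \<open>N\<close> of the first \<open>k\<close> is the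
  unique step at which the chain leaves \<open>N\<close>.\<close>

lemma chain_steps_le:
  assumes inv: "\<And>j. rep_invariant \<psi> S (U j)" and mono: "\<And>j. U j \<subseteq> U (Suc j)"
    and irr: "\<And>i. i < k \<Longrightarrow> rep_irreducible_sub \<psi> S (Vs i)"
  shows "card {j. j < m \<and> U j \<inter> partial_sum Vs k \<noteq> U (Suc j) \<inter> partial_sum Vs k} \<le> k"
  using irr
proof (induction k)
  case 0
  have "U j \<inter> {0} = U (Suc j) \<inter> {0}" for j using rep_invariant_0[OF inv] by auto
  then show ?case by simp
next
  case (Suc k)
  define N M where "N = partial_sum Vs k" and "M = partial_sum Vs (Suc k)"
  have irr: "rep_irreducible_sub \<psi> S (Vs k)" using Suc.prems by simp
  note V = rep_irreducible_subD[OF irr]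
  have N: "rep_invariant \<psi> S N"
    unfolding N_def
    by (rule rep_invariant_partial_sum, rule rep_irreducible_subD(1), rule Suc.prems) simp
  have NM: "N \<subseteq> M" using rep_invariant_0[OF V(1)] partial_sum_Suc[of _ Vs k] unfolding N_def M_def by force
  have M: "\<exists>n\<in>N. \<exists>v\<in>Vs k. y = n + v" if "y \<in> M" for y
    using that partial_sum_Suc[of y Vs k] by (simp add: N_def M_def)
  define J where "J = {j. j < m \<and> U j \<inter> M \<subseteq> N \<and> \<not> U (Suc j) \<inter> M \<subseteq> N}"
  have incr: "i \<le> j \<Longrightarrow> U i \<subseteq> U j" for i j using mono by (rule lift_Suc_mono_le)
  have "j = j'" if "j \<in> J" "j' \<in> J" for j j'
  proof (rule ccontr)
    have *: False if "j \<in> J" "j' \<in> J" "j < j'" for j j'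
      using that(1,2) incr[OF Suc_leI[OF that(3)]] unfolding J_def by blast
    assume "j \<noteq> j'"
    then show False using *[of j j'] *[of j' j] that by linarith
  qed
  then have J1: "card J \<le> 1" by (auto simp: card_le_Suc0_iff_eq J_def)
  have sub: "{j. j < m \<and> U j \<inter> M \<noteq> U (Suc j) \<inter> M} \<subseteq> {j. j < m \<and> U j \<inter> N \<noteq> U (Suc j) \<inter> N} \<union> J"
  proof
    fix j assume j: "j \<in> {j. j < m \<and> U j \<inter> M \<noteq> U (Suc j) \<inter> M}"
    show "j \<in> {j. j < m \<and> U j \<inter> N \<noteq> U (Suc j) \<inter> N} \<union> J"
    proof (rule ccontr)
      assume a: "j \<notin> {j. j < m \<and> U j \<inter> N \<noteq> U (Suc j) \<inter> N} \<union> J"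
      then have eq: "U j \<inter> N = U (Suc j) \<inter> N" using j by blast
      have "\<not> U (Suc j) \<inter> M \<subseteq> N" using j eq mono[of j] by blast
      then have "\<not> U j \<inter> M \<subseteq> N" using a j unfolding J_def by blast
      then obtain x where x: "x \<in> U j" "x \<in> M" "x \<notin> N" by blast
      \<comment> \<open>The components in the new summand of those vectors of \<open>U j\<close>
        that lie in \<open>M\<close>. The vector \<open>x\<close> makes \<open>W\<close> nonzero, so
        irreducibility makes it the whole summand.\<close>
      define W where "W = {v\<in>Vs k. \<exists>n\<in>N. n + v \<in> U j}"
      have "rep_invariant \<psi> S W"
        unfolding rep_invariant_def cplx_subspace_def
      proof (intro conjI ballI allI)
        show "0 \<in> W" using rep_invariant_0 V(1) N inv unfolding W_def by force
        show "v + v' \<in> W" if vv: "v \<in> W" "v' \<in> W" for v v'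
        proof -
          obtain n n' where "n \<in> N" "n' \<in> N" "n + v \<in> U j" "n' + v' \<in> U j" "v \<in> Vs k" "v' \<in> Vs k"
            using vv unfolding W_def by blast
          then have "n + n' \<in> N" "(n + n') + (v + v') \<in> U j" "v + v' \<in> Vs k"
            using N V(1) inv[of j] vec.subspace_add[of "U j" "n + v" "n' + v'"]
            by (auto simp: rep_invariant_iff vec.subspace_add algebra_simps)
          then show ?thesis unfolding W_def by blast
        qed
        show "c *s v \<in> W" if v: "v \<in> W" for c v
        proof -
          obtain n where "n \<in> N" "n + v \<in> U j" "v \<in> Vs k" using v unfolding W_def by blast
          then have "c *s n \<in> N" "c *s n + c *s v \<in> U j" "c *s v \<in> Vs k"
            using N V(1) inv[of j] vec.subspace_scale[of "U j" "n + v" c]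
            by (auto simp: rep_invariant_iff vec.subspace_scale vec.scale_right_distrib)
          then show ?thesis unfolding W_def by blast
        qed
        show "\<psi> x *v v \<in> W" if v: "x \<in> S" "v \<in> W" for x v
        proof -
          obtain n where "n \<in> N" "n + v \<in> U j" "v \<in> Vs k" using v unfolding W_def by blast
          then have "\<psi> x *v n \<in> N" "\<psi> x *v (n + v) \<in> U j" "\<psi> x *v v \<in> Vs k"
            using N V(1) inv[of j] v(1) unfolding rep_invariant_def by blast+
          then show ?thesis unfolding W_def matrix_vector_right_distrib by blast
        qed
      qed
      moreover have "W \<subseteq> Vs k" by (auto simp: W_def)
      moreover have "W \<noteq> {0}"
      proof
        assume W0: "W = {0}"
        obtain n v where nv: "n \<in> N" "v \<in> Vs k" "x = n + v" using M x by blast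
        then have "v \<in> W" using x(1) unfolding W_def by blast
        then show False using W0 nv x(3) by simp
      qed
      ultimately have W: "W = Vs k" using V(3) by blast
      \<comment> \<open>Match the component of \<open>y\<close> in the new summand by an element of
        \<open>U j\<close>; the difference lies in \<open>N\<close> and \<open>U (Suc j)\<close>,
        where the two chain members agree.\<close>
      have "y \<in> U j" if y: "y \<in> U (Suc j)" "y \<in> M" for y
      proof -
        obtain n v where nv: "n \<in> N" "v \<in> Vs k" "y = n + v" using M y by blast
        then obtain n' where n': "n' \<in> N" "n' + v \<in> U j" using W unfolding W_def by blast
        have "n - n' = y - (n' + v)" using nv by simp
        then have "n - n' \<in> U (Suc j)"
          using rep_invariant_diff[OF inv y(1)] n'(2) mono by (metis subsetD)
        then have "n - n' \<in> U j" using eq rep_invariant_diff[OF N nv(1) n'(1)] by blast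
        then have "(n - n') + (n' + v) \<in> U j"
          using n'(2) inv[of j] by (simp only: rep_invariant_iff vec.subspace_add)
        then show ?thesis using nv by simp
      qed
      then have "U j \<inter> M = U (Suc j) \<inter> M" using mono[of j] by blast
      then show False using j by simp
    qed
  qed
  have "card {j. j < m \<and> U j \<inter> M \<noteq> U (Suc j) \<inter> M} \<le> card ({j. j < m \<and> U j \<inter> N \<noteq> U (Suc j) \<inter> N} \<union> J)"
    by (rule card_mono[OF _ sub]) (auto simp: J_def)
  also have "\<dots> \<le> card {j. j < m \<and> U j \<inter> N \<noteq> U (Suc j) \<inter> N} + card J" by (rule card_Un_le)
  also have "\<dots> \<le> k + 1" using Suc J1 by (intro add_mono) (auto simp: N_def)
  finally show ?case by (simp add: M_def)
qed

text \<open>Peels off the last summand: it meets the sum of the earlier ones trivially, so its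
  component vanishes. This turns the stepwise condition into uniqueness of components.\<close>

lemma direct_sum_unique:
  assumes "\<And>i. i < k \<Longrightarrow> vec.subspace (Vs i)" "\<And>i. i < k \<Longrightarrow> partial_sum Vs i \<inter> Vs i \<subseteq> {0}"
    and "\<And>i. i < k \<Longrightarrow> w i \<in> Vs i" "(\<Sum>i<k. w i) = 0" "i < k"
  shows "w i = 0"
  using assms
proof (induction k)
  case (Suc k)
  have "(\<Sum>i<k. w i) = - w k" using Suc.prems(4) by (simp add: eq_neg_iff_add_eq_0)
  then have "- w k \<in> partial_sum Vs k"
    using Suc.prems(3) unfolding partial_sum_def by (intro CollectI exI[of _ w]) auto
  moreover have "- w k \<in> Vs k" using Suc.prems(1,3) by (simp add: vec.subspace_neg)
  ultimately have "w k = 0" using Suc.prems(2)[of k] by auto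
  then show ?case using Suc by (cases "i = k") (auto simp: less_Suc_eq)
qed simp

lemma rep_decomposesI:
  assumes irr: "\<And>i. i < k \<Longrightarrow> rep_irreducible_sub \<psi> S (Vs i)"
    and direct: "\<And>i. i < k \<Longrightarrow> partial_sum Vs i \<inter> Vs i \<subseteq> {0}" and total: "partial_sum Vs k = UNIV"
  shows "rep_decomposes \<psi> S k"
  unfolding rep_decomposes_def
proof (intro exI[of _ Vs] conjI allI impI)
  fix v
  have "v \<in> partial_sum Vs k" using total by simp
  then obtain w where w: "v = (\<Sum>i<k. w i)" "\<And>i. i < k \<Longrightarrow> w i \<in> Vs i" by (auto simp: partial_sum_def)
  have sub: "vec.subspace (Vs i)" if "i < k" for i
    using irr[OF that] by (auto simp: rep_irreducible_sub_def rep_invariant_iff)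
  show "\<exists>!w. (\<forall>i<k. w i \<in> Vs i) \<and> (\<forall>i\<ge>k. w i = 0) \<and> v = (\<Sum>i<k. w i)"
  proof (rule ex1I[of _ "\<lambda>i. if i < k then w i else 0"])
    show "(\<forall>i<k. (if i < k then w i else 0) \<in> Vs i) \<and> (\<forall>i\<ge>k. (if i < k then w i else 0) = 0) \<and>
      v = (\<Sum>i<k. if i < k then w i else 0)" using w by simp
    fix u assume u: "(\<forall>i<k. u i \<in> Vs i) \<and> (\<forall>i\<ge>k. u i = 0) \<and> v = (\<Sum>i<k. u i)"
    have "(\<Sum>i<k. u i - w i) = 0" using u w by (simp add: sum_subtractf)
    then have "u i - w i = 0" if "i < k" for i
      using direct_sum_unique[of k Vs "\<lambda>i. u i - w i" i] that u w sub direct by (auto simp: vec.subspace_diff)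
    then show "u = (\<lambda>i. if i < k then w i else 0)" using u by (auto simp: fun_eq_iff)
  qed
qed (rule irr)

lemma rep_decomposesE:
  assumes "rep_decomposes \<psi> S k"
  obtains Vs where "\<And>i. i < k \<Longrightarrow> rep_irreducible_sub \<psi> S (Vs i)"
    "\<And>i. i < k \<Longrightarrow> partial_sum Vs i \<inter> Vs i \<subseteq> {0}" "partial_sum Vs k = UNIV"
proof -
  obtain Vs where irr: "\<And>i. i < k \<Longrightarrow> rep_irreducible_sub \<psi> S (Vs i)"
    and uniq: "\<And>v. \<exists>!w. (\<forall>i<k. w i \<in> Vs i) \<and> (\<forall>i\<ge>k. w i = 0) \<and> v = (\<Sum>i<k. w i)"
    using assms unfolding rep_decomposes_def by blast
  have z: "0 \<in> Vs i" if "i < k" for i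
    using irr[OF that] rep_invariant_0 rep_irreducible_subD(1) by blast
  have "partial_sum Vs k = UNIV" using uniq unfolding partial_sum_def by blast
  moreover have "partial_sum Vs i \<inter> Vs i \<subseteq> {0}" if i: "i < k" for i
  proof
    fix v assume "v \<in> partial_sum Vs i \<inter> Vs i"
    then obtain w where w: "v = (\<Sum>j<i. w j)" "\<And>j. j < i \<Longrightarrow> w j \<in> Vs j" and v: "v \<in> Vs i"
      by (auto simp: partial_sum_def)
    \<comment> \<open>Two expansions of the same \<open>v\<close>: \<open>a\<close> uses the
      summands before \<open>i\<close>, \<open>b\<close> only the summand \<open>i\<close>.
      Uniqueness equates them, and \<open>a i\<close> is zero.\<close>
    define a where "a j = (if j < i then w j else 0)" for j
    define b where "b j = (if j = i then v else 0)" for j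
    have "(\<Sum>j<k. a j) = (\<Sum>j\<in>{..<i}. a j)"
      by (rule sum.mono_neutral_right) (use i in \<open>auto simp: a_def\<close>)
    then have A: "(\<forall>j<k. a j \<in> Vs j) \<and> (\<forall>j\<ge>k. a j = 0) \<and> v = (\<Sum>j<k. a j)"
      using w i z by (simp add: a_def)
    have B: "(\<forall>j<k. b j \<in> Vs j) \<and> (\<forall>j\<ge>k. b j = 0) \<and> v = (\<Sum>j<k. b j)"
      using v i z by (simp add: b_def)
    have "a = b" by (rule ex1E[OF uniq[of v]]) (use A B in metis)
    then have "b i = 0" by (metis a_def less_irrefl)
    then show "v \<in> {0}" by (simp add: b_def)
  qed
  ultimately show ?thesis using that irr by blast
qed

text \<open>When the summands fill the whole space, every strict step of the chain is visible and is
  counted by \<open>chain_steps_le\<close>.\<close>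

lemma rep_decomposes_chain_le:
  assumes "rep_decomposes \<psi> S k" and inv: "\<And>j. rep_invariant \<psi> S (U j)"
    and mono: "\<And>j. U j \<subseteq> U (Suc j)" and strict: "\<And>j. j < m \<Longrightarrow> U j \<noteq> U (Suc j)"
  shows "m \<le> k"
proof -
  obtain Vs where Vs: "\<And>i. i < k \<Longrightarrow> rep_irreducible_sub \<psi> S (Vs i)" "partial_sum Vs k = UNIV"
    using assms(1) by (rule rep_decomposesE) (rule that)
  have "card {j. j < m \<and> U j \<noteq> U (Suc j)} \<le> k"
    using chain_steps_le[of \<psi> S U k Vs m] inv mono Vs by simp
  moreover have "{j. j < m \<and> U j \<noteq> U (Suc j)} = {..<m}" using strict by auto
  ultimately show ?thesis by simp
qed

context
  fixes \<psi> :: "'a \<Rightarrow> complex^'n^'n" and S :: "'a set" and k and Vs :: "nat \<Rightarrow> (complex^'n) set"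
  assumes inv: "\<And>i. i < k \<Longrightarrow> rep_invariant \<psi> S (Vs i)" and nz: "\<And>i. i < k \<Longrightarrow> Vs i \<noteq> {0}"
    and direct: "\<And>i. i < k \<Longrightarrow> partial_sum Vs i \<inter> Vs i \<subseteq> {0}"
begin

lemma partial_sum_invariant: "i \<le> k \<Longrightarrow> rep_invariant \<psi> S (partial_sum Vs i)"
  by (rule rep_invariant_partial_sum) (use inv in auto)

lemma partial_sum_strict: assumes "i < k" shows "partial_sum Vs i \<subset> partial_sum Vs (Suc i)"
proof -
  have "0 \<in> Vs i" "0 \<in> partial_sum Vs i"
    using rep_invariant_0 inv partial_sum_invariant[of i] assms by auto
  moreover obtain v where v: "v \<in> Vs i" "v \<noteq> 0" using nz[OF assms] \<open>0 \<in> Vs i\<close> by blast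
  ultimately have "v \<in> partial_sum Vs (Suc i)"
    unfolding partial_sum_Suc by (intro bexI[of _ 0] bexI[of _ v]) simp_all
  moreover have "v \<notin> partial_sum Vs i" using direct[OF assms] v by blast
  moreover have "x \<in> partial_sum Vs (Suc i)" if "x \<in> partial_sum Vs i" for x
    using that \<open>0 \<in> Vs i\<close> by (force simp: partial_sum_Suc)
  ultimately show ?thesis by blast
qed

lemma summands_le:
  assumes "rep_decomposes \<psi> S l" shows "k \<le> l"
\<comment> \<open>The minimum with \<open>k\<close> freezes the chain after its last strict step, as
  the chain must be defined at all indices.\<close>
proof (rule rep_decomposes_chain_le[OF assms, where U = "\<lambda>j. partial_sum Vs (min j k)"])
  show "rep_invariant \<psi> S (partial_sum Vs (min j k))" for j by (rule partial_sum_invariant) simp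
  show "partial_sum Vs (min j k) \<subseteq> partial_sum Vs (min (Suc j) k)" for j
    using partial_sum_strict[of j] by (cases "j < k") (auto simp: min_def)
  show "partial_sum Vs (min j k) \<noteq> partial_sum Vs (min (Suc j) k)" if "j < k" for j
    using partial_sum_strict[of j] that by (auto simp: min_def)
qed

text \<open>A proper invariant subspace of one summand refines the chain of partial sums by one more
  strict step.\<close>

lemma reducible_summand_imp_less:
  assumes l: "rep_decomposes \<psi> S l" and i: "i < k" and W: "rep_invariant \<psi> S W" "W \<subset> Vs i" "W \<noteq> {0}"
  shows "k < l"
proof -
  define N where "N = partial_sum Vs"
  define R where "R = {x + y |x y. x \<in> N i \<and> y \<in> W}"
  have N: "rep_invariant \<psi> S (N j)" if "j \<le> k" for j using partial_sum_invariant that by (simp add: N_def)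
  have R: "rep_invariant \<psi> S R" unfolding R_def using N i W by (intro rep_invariant_plus) auto
  have z: "0 \<in> N i" "0 \<in> W" using N[of i] i W rep_invariant_0 by auto
  have NR: "N i \<subset> R"
  proof -
    obtain w where w: "w \<in> W" "w \<noteq> 0" using W z by blast
    then have "w \<notin> N i" using direct[OF i] W by (auto simp: N_def)
    moreover have "w \<in> R" using w z unfolding R_def by force
    moreover have "x \<in> R" if "x \<in> N i" for x using that z unfolding R_def by force
    ultimately show ?thesis by blast
  qed
  have RN: "R \<subset> N (Suc i)"
  proof -
    have "R \<subseteq> N (Suc i)" using W unfolding R_def N_def partial_sum_Suc subset_iff by blast
    moreover obtain v where v: "v \<in> Vs i" "v \<notin> W" using W by blast
    have "v \<notin> R"
    proof
      assume "v \<in> R"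
      then obtain x y where xy: "v = x + y" "x \<in> N i" "y \<in> W" unfolding R_def by blast
      then have "x = v - y" by simp
      then have "x \<in> Vs i" using rep_invariant_diff[OF inv[OF i] v(1)] xy W by blast
      then have "x = 0" using direct[OF i] xy by (auto simp: N_def)
      then show False using xy v by simp
    qed
    moreover have "v \<in> N (Suc i)" using v z unfolding N_def partial_sum_Suc by force
    ultimately show ?thesis by blast
  qed
  \<comment> \<open>\<open>R\<close> is inserted right after \<open>N i\<close>, so later indices
    are shifted by one and then frozen at \<open>k\<close>.\<close>
  define U where "U j = (if j \<le> i then N j else if j = Suc i then R else N (min (j - 1) k))" for j
  have step: "N j \<subset> N (Suc j)" if "j < k" for j using partial_sum_strict that by (simp add: N_def)
  have strict: "U j \<subset> U (Suc j)" if "j < Suc k" for j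
  proof -
    consider "j < i" | "j = i" | "j = Suc i" | "Suc i < j" by linarith
    then show ?thesis
    proof cases
      case 1
      then show ?thesis using step[of j] i by (simp add: U_def)
    next
      case 2
      then show ?thesis using NR by (simp add: U_def)
    next
      case 3
      then show ?thesis using RN i by (simp add: U_def min_def)
    next
      case 4
      then have "j - 1 < k" "Suc (j - 1) = j" "j \<le> k" using that by linarith+
      then show ?thesis using step[of "j - 1"] 4 by (simp add: U_def min_def)
    qed
  qed
  have "Suc k \<le> l"
  proof (rule rep_decomposes_chain_le[OF l, where U = U])
    show "rep_invariant \<psi> S (U j)" for j using N R i by (simp add: U_def)
    show "U j \<subseteq> U (Suc j)" for j
    proof (cases "j < Suc k")
      case True
      then show ?thesis using strict by blast
    next
      case False
      then have "min (j - 1) k = k" "min j k = k" by linarith+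
      then show ?thesis using i False by (simp add: U_def)
    qed
    show "U j \<noteq> U (Suc j)" if "j < Suc k" for j using strict[OF that] by blast
  qed
  then show ?thesis by simp
qed

text \<open>Bounds the size of a direct family, so that a largest one exists.\<close>

lemma le_dim: "k \<le> CARD('n)"
proof -
  have "i \<le> k \<Longrightarrow> i \<le> vec.dim (partial_sum Vs i)" for i
  proof (induction i)
    case (Suc i)
    have "vec.span (partial_sum Vs j) = partial_sum Vs j" if "j \<le> k" for j
      using partial_sum_invariant[OF that] by (simp add: rep_invariant_iff vec.span_eq_iff)
    then have "vec.dim (partial_sum Vs i) < vec.dim (partial_sum Vs (Suc i))"
      using partial_sum_strict[of i] Suc.prems by (intro vec.dim_psubset) (metis Suc_le_lessD less_imp_le)
    then show ?case using Suc by simp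
  qed simp
  from this[of k] show ?thesis
    using vec.dim_subset[of "partial_sum Vs k" UNIV] vec_dim_card[where 'a=complex and 'n='n] by simp
qed

end

lemma rep_decomposes_unique:
  assumes "rep_decomposes \<psi> S k" "rep_decomposes \<psi> S l" shows "k = l"
proof -
  have "k \<le> l" if dec: "rep_decomposes \<psi> S k" "rep_decomposes \<psi> S l" for k l
  proof -
    obtain Vs where Vs: "\<And>i. i < k \<Longrightarrow> rep_irreducible_sub \<psi> S (Vs i)"
      "\<And>i. i < k \<Longrightarrow> partial_sum Vs i \<inter> Vs i \<subseteq> {0}"
      using dec(1) by (rule rep_decomposesE) (rule that)
    show ?thesis by (rule summands_le[OF _ _ Vs(2) dec(2)]) (auto dest: Vs(1) rep_irreducible_subD)
  qed
  then show ?thesis using assms by (simp add: order_antisym)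
qed

lemma rep_norm1_eqI: "rep_decomposes \<psi> S k \<Longrightarrow> rep_norm1 \<psi> S = k"
  unfolding rep_norm1_def using rep_decomposes_unique by blast

section \<open>Existence of irreducible decompositions\<close>

lemma irreducible_sub_exists:
  assumes "rep_invariant \<psi> S U" "U \<noteq> {0}"
  shows "\<exists>V\<subseteq>U. rep_irreducible_sub \<psi> S V"
  using assms
proof (induction "vec.dim U" arbitrary: U rule: less_induct)
  case less
  show ?case
  proof (cases "rep_irreducible_sub \<psi> S U")
    case False
    then obtain W where W: "rep_invariant \<psi> S W" "W \<subseteq> U" "W \<noteq> {0}" "W \<noteq> U"
      using less.prems unfolding rep_irreducible_sub_def by blast
    then have "vec.dim W < vec.dim U"
      using less.prems by (intro vec.dim_psubset) (auto simp: rep_invariant_iff vec.span_eq_iff[THEN iffD2])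
    from less.hyps[OF this W(1,3)] show ?thesis using W(2) by blast
  qed blast
qed

text \<open>A direct family of irreducibles of maximal size exhausts the space, since a nonzero
  invariant complement would contain one more irreducible.\<close>

lemma rep_decomposes_exists:
  fixes \<psi> :: "'a \<Rightarrow> complex^'n^'n"
  assumes "completely_reducible \<psi> S" shows "\<exists>k. rep_decomposes \<psi> S k"
proof -
  define P where "P k \<longleftrightarrow> (\<exists>Vs. (\<forall>i<k. rep_irreducible_sub \<psi> S (Vs i)) \<and>
    (\<forall>i<k. partial_sum Vs i \<inter> Vs i \<subseteq> {0}))" for k
  have "P 0" by (simp add: P_def)
  moreover have "k \<le> CARD('n)" if Pk: "P k" for k
  proof -
    obtain Vs where Vs: "\<And>i. i < k \<Longrightarrow> rep_irreducible_sub \<psi> S (Vs i)"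
      "\<And>i. i < k \<Longrightarrow> partial_sum Vs i \<inter> Vs i \<subseteq> {0}" using Pk unfolding P_def by blast
    show ?thesis by (rule le_dim[of k \<psi> S Vs, OF _ _ Vs(2)]) (auto dest: Vs(1) rep_irreducible_subD)
  qed
  ultimately obtain k where k: "P k" "\<And>l. P l \<Longrightarrow> l \<le> k"
    using Greatest_le_nat[of P _ "CARD('n)"] GreatestI_nat[of P 0 "CARD('n)"] by blast
  then obtain Vs where Vs: "\<And>i. i < k \<Longrightarrow> rep_irreducible_sub \<psi> S (Vs i)"
    "\<And>i. i < k \<Longrightarrow> partial_sum Vs i \<inter> Vs i \<subseteq> {0}" unfolding P_def by blast
  have "rep_invariant \<psi> S (partial_sum Vs k)"
    by (rule rep_invariant_partial_sum) (use Vs(1) rep_irreducible_subD in blast)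
  then obtain U where U: "rep_invariant \<psi> S U" "partial_sum Vs k \<inter> U = {0}"
    "\<And>v. \<exists>w\<in>partial_sum Vs k. v - w \<in> U"
    using completely_reducibleE[OF assms] by blast
  have "U = {0}"
  proof (rule ccontr)
    assume "U \<noteq> {0}"
    then obtain V where V: "V \<subseteq> U" "rep_irreducible_sub \<psi> S V" using irreducible_sub_exists U(1) by blast
    define Ws where "Ws = Vs(k := V)"
    have ps: "partial_sum Ws i = partial_sum Vs i" if "i \<le> k" for i
      by (rule partial_sum_cong) (use that in \<open>simp add: Ws_def\<close>)
    have "rep_irreducible_sub \<psi> S (Ws i)" if "i < Suc k" for i
      using that Vs(1) V(2) by (auto simp: Ws_def less_Suc_eq)
    moreover have "partial_sum Ws i \<inter> Ws i \<subseteq> {0}" if "i < Suc k" for i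
    proof (cases "i = k")
      case True
      then show ?thesis using U(2) V(1) ps[of k] by (auto simp: Ws_def)
    next
      case False
      then show ?thesis using that Vs(2)[of i] ps[of i] by (simp add: Ws_def)
    qed
    ultimately have "P (Suc k)" unfolding P_def by blast
    then show False using k(2) by fastforce
  qed
  have "v \<in> partial_sum Vs k" for v
    using U(3)[of v] \<open>U = {0}\<close> by auto
  then have "partial_sum Vs k = UNIV" by blast
  then show ?thesis using rep_decomposesI[of k \<psi> S Vs] Vs by blast
qed

subsection \<open>Invariants of a subalgebra with the same number of irreducible summands\<close>

lemma matrix_vector_sum_right: "X *v (\<Sum>i\<in>I. f i) = (\<Sum>i\<in>I. X *v (f i::complex^'n))"
  by (induction I rule: infinite_finite_induct) (auto simp: matrix_vector_right_distrib)

context invariant_lie_algebra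
begin

context
  fixes \<psi> :: "'a \<Rightarrow> complex^'n^'n" and H :: "'a set"
  assumes rep: "lie_rep B \<psi>" and H: "lie_subalgebra B H"
    and norm: "rep_norm1 \<psi> H = rep_norm1 \<psi> UNIV"
begin

text \<open>A summand that became reducible over \<open>H\<close> would force more summands over
  \<open>H\<close> than over the full algebra, against \<open>norm\<close>.\<close>

lemma common_decomposition:
  obtains k Vs where "\<And>i. i < k \<Longrightarrow> rep_irreducible_sub \<psi> UNIV (Vs i)"
    "\<And>i. i < k \<Longrightarrow> rep_irreducible_sub \<psi> H (Vs i)"
    "\<And>i. i < k \<Longrightarrow> partial_sum Vs i \<inter> Vs i \<subseteq> {0}" "partial_sum Vs k = UNIV"
proof -
  obtain k where k: "rep_decomposes \<psi> UNIV k"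
    using rep_decomposes_exists[OF completely_reducible_UNIV[OF rep]] by blast
  obtain l where l: "rep_decomposes \<psi> H l"
    using rep_decomposes_exists[OF completely_reducible_subalgebra[OF rep H]] by blast
  have kl: "l = k" using rep_norm1_eqI[OF k] rep_norm1_eqI[OF l] norm by simp
  obtain Vs where Vs: "\<And>i. i < k \<Longrightarrow> rep_irreducible_sub \<psi> UNIV (Vs i)"
    "\<And>i. i < k \<Longrightarrow> partial_sum Vs i \<inter> Vs i \<subseteq> {0}" "partial_sum Vs k = UNIV"
    using k by (rule rep_decomposesE) (rule that)
  have inv: "rep_invariant \<psi> H (Vs i)" and nz: "Vs i \<noteq> {0}" if "i < k" for i
    using rep_irreducible_subD(1,2)[OF Vs(1)[OF that]] rep_invariant_mono[OF _ subset_UNIV] by blast+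
  have "rep_irreducible_sub \<psi> H (Vs i)" if i: "i < k" for i
    unfolding rep_irreducible_sub_def
  proof (intro conjI allI impI inv nz i)
    fix W assume W: "rep_invariant \<psi> H W \<and> W \<subseteq> Vs i"
    show "W = {0} \<or> W = Vs i"
    proof (rule ccontr)
      assume "\<not> ?thesis"
      then have "k < l"
        using W by (intro reducible_summand_imp_less[OF inv nz Vs(2) l i, of W]) auto
      then show False using kl by simp
    qed
  qed
  with Vs show ?thesis by (intro that)
qed

lemma casimir_commutes_with_all:
  assumes A: "Q_basis A H"
  shows "casimir \<psi> A *v (\<psi> y *v v) = \<psi> y *v (casimir \<psi> A *v v)"
proof -
  define C where "C = casimir \<psi> A"
  obtain k Vs where Vs: "\<And>i. i < k \<Longrightarrow> rep_irreducible_sub \<psi> UNIV (Vs i)"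
    "\<And>i. i < k \<Longrightarrow> rep_irreducible_sub \<psi> H (Vs i)" "partial_sum Vs k = UNIV"
    by (rule common_decomposition) (rule that)
  have summand: "C *v (\<psi> y *v v) = \<psi> y *v (C *v v)" if i: "i < k" and v: "v \<in> Vs i" for i v
  proof -
    note irr = rep_irreducible_subD[OF Vs(2)[OF i]] and inv = rep_irreducible_subD(1)[OF Vs(1)[OF i]]
    have sub: "vec.subspace (Vs i)" using irr(1) by (simp add: rep_invariant_iff)
    have \<psi>V: "\<psi> x *v u \<in> Vs i" if "u \<in> Vs i" for x u using inv that by (simp add: rep_invariant_def)
    have "maps_to C (Vs i) (Vs i)"
      unfolding maps_to_def C_def casimir_vector by (intro ballI vec.subspace_sum sub \<psi>V)
    then obtain w \<mu> where w: "w \<in> Vs i" "w \<noteq> 0" "C *v w = \<mu> *s w"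
      using eigenvector_exists[OF sub _ irr(2)] by metis
    \<comment> \<open>Schur's argument: the eigenspace of \<open>C\<close> in the summand is
      \<open>H\<close>-invariant, so it is the whole summand and \<open>C\<close> is scalar
      there.\<close>
    define W where "W = {u \<in> Vs i. C *v u = \<mu> *s u}"
    have "rep_invariant \<psi> H W"
      unfolding rep_invariant_iff
    proof (intro conjI ballI)
      show "vec.subspace W"
        using sub by (auto simp: W_def vec.subspace_def matrix_vector_right_distrib matrix_vector_smult
            vec.scale_right_distrib mult.commute)
      fix x assume x: "x \<in> H"
      have "C *v (\<psi> x *v u) = \<psi> x *v (C *v u)" for u
        unfolding C_def matrix_vector_mul_assoc casimir_commute[OF rep A H x] ..
      then show "maps_to (\<psi> x) W W"
        using \<psi>V by (auto simp: W_def maps_to_def matrix_vector_smult)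
    qed
    moreover have "W \<subseteq> Vs i" "W \<noteq> {0}" using w by (auto simp: W_def)
    ultimately have "W = Vs i" using irr(3) by blast
    then have "C *v u = \<mu> *s u" if "u \<in> Vs i" for u using that by (auto simp: W_def)
    then show ?thesis using \<psi>V v by (simp add: matrix_vector_smult)
  qed
  have "v \<in> partial_sum Vs k" using Vs(3) by simp
  then obtain w where "v = (\<Sum>i<k. w i)" "\<And>i. i < k \<Longrightarrow> w i \<in> Vs i" by (auto simp: partial_sum_def)
  then show ?thesis
    using summand unfolding C_def by (simp add: matrix_vector_sum_right)
qed

text \<open>Each component of an \<open>H\<close>-invariant vector is \<open>H\<close>-invariant, so
  a nonzero one spans its \<open>H\<close>-irreducible summand. The full algebra acts on this line
  by scalars, which commute, so brackets act as zero and perfectness applies.\<close>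

lemma invariants_eq:
  assumes v: "\<And>x. x \<in> H \<Longrightarrow> \<psi> x *v v = 0" shows "\<psi> y *v v = 0"
proof -
  obtain k Vs where Vs: "\<And>i. i < k \<Longrightarrow> rep_irreducible_sub \<psi> UNIV (Vs i)"
    "\<And>i. i < k \<Longrightarrow> rep_irreducible_sub \<psi> H (Vs i)"
    "\<And>i. i < k \<Longrightarrow> partial_sum Vs i \<inter> Vs i \<subseteq> {0}" "partial_sum Vs k = UNIV"
    by (rule common_decomposition) (rule that)
  have sub: "vec.subspace (Vs i)" if "i < k" for i
    using rep_irreducible_subD(1)[OF Vs(1)[OF that]] by (simp add: rep_invariant_iff)
  have \<psi>V: "\<psi> x *v u \<in> Vs i" if "i < k" "u \<in> Vs i" for i x u
    using rep_irreducible_subD(1)[OF Vs(1)[OF that(1)]] that(2) by (simp add: rep_invariant_def)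
  have "v \<in> partial_sum Vs k" using Vs(4) by simp
  then obtain w where w: "v = (\<Sum>i<k. w i)" "\<And>i. i < k \<Longrightarrow> w i \<in> Vs i" by (auto simp: partial_sum_def)
  have "\<psi> y *v w i = 0" if i: "i < k" for i
  proof (cases "w i = 0")
    case False
    have triv: "\<psi> x *v w i = 0" if x: "x \<in> H" for x
    proof (rule direct_sum_unique[of k Vs "\<lambda>i. \<psi> x *v w i"])
      show "(\<Sum>i<k. \<psi> x *v w i) = 0" using v[OF x] by (simp add: w(1) matrix_vector_sum_right)
    qed (use sub Vs(3) \<psi>V w(2) i in auto)
    define L where "L = vec.span {w i}"
    have "maps_to (\<psi> x) L L" if "x \<in> H" for x
      using triv[OF that] by (auto simp: L_def maps_to_def vec.span_singleton matrix_vector_smult vec.span_zero)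
    then have "rep_invariant \<psi> H L" by (simp add: rep_invariant_iff L_def)
    moreover have "L \<subseteq> Vs i" unfolding L_def by (rule vec.span_minimal) (use sub w(2) i in auto)
    moreover have "w i \<in> L" by (simp add: L_def vec.span_base)
    ultimately have L: "L = Vs i" using rep_irreducible_subD(3)[OF Vs(2)[OF i]] False by blast
    have "\<exists>c. \<psi> x *v w i = c *s w i" for x
      using \<psi>V[OF i w(2)[OF i], of x] unfolding L[symmetric] L_def by (auto simp: vec.span_singleton)
    then obtain c where c: "\<And>x. \<psi> x *v w i = c x *s w i" by metis
    have "subspace {x. maps_to (\<psi> x) L {0}}"
      by (rule lie_rep_subspace_preserving[OF rep]) (simp_all add: L_def)
    moreover have "B x z \<in> {x. maps_to (\<psi> x) L {0}}" for x z
    proof -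
      have "\<psi> x *v (\<psi> z *v w i) = \<psi> z *v (\<psi> x *v w i)"
        by (simp add: c matrix_vector_smult mult.commute)
      then have "\<psi> (B x z) *v w i = 0" using lie_rep_vector[OF rep, of x z "w i"] by simp
      then show ?thesis by (auto simp: maps_to_def L_def vec.span_singleton matrix_vector_smult)
    qed
    ultimately have "y \<in> {x. maps_to (\<psi> x) L {0}}" by (rule perfect)
    then show ?thesis using \<open>w i \<in> L\<close> by (auto simp: maps_to_def)
  qed simp
  then show ?thesis by (simp add: w(1) matrix_vector_sum_right)
qed

end

end

subsection \<open>The subalgebra is an ideal\<close>

text \<open>The matrices \<open>E j k\<close> are the matrix units. The identity recovers a
  contraction of the tensor of \<open>P\<close> and \<open>R\<close> from the operator X \<mapsto> P
  X R.\<close>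

lemma trace_contraction:
  fixes P R Z W :: "complex^'n^'n"
  defines "E \<equiv> \<lambda>j k. \<chi> a b. if a = j \<and> b = k then 1 else 0"
  shows "trace (P ** Z) * trace (R ** W) =
    (\<Sum>j\<in>UNIV. \<Sum>k\<in>UNIV. \<Sum>i\<in>UNIV. \<Sum>l\<in>UNIV. Z $ j $ i * W $ l $ k * (P ** E j k ** R) $ i $ l)"
proof -
  have PE: "(P ** E j k) $ i $ b = (if b = k then P $ i $ j else 0)" for i j k b
  proof -
    have "P $ i $ a * (if a = j \<and> b = k then 1 else 0) = (if a = j then (if b = k then P $ i $ j else 0) else 0)" for a
      by simp
    then show ?thesis by (simp add: matrix_matrix_mult_def E_def)
  qed
  have PER: "(P ** E j k ** R) $ i $ l = P $ i $ j * R $ k $ l" for i j k l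
  proof -
    have "(if b = k then P $ i $ j else 0) * R $ b $ l = (if b = k then P $ i $ j * R $ k $ l else 0)" for b
      by simp
    then show ?thesis by (simp add: matrix_matrix_mult_def[of "P ** E j k"] PE)
  qed
  have "trace (P ** Z) * trace (R ** W) =
      (\<Sum>j\<in>UNIV. \<Sum>i\<in>UNIV. P $ i $ j * Z $ j $ i) * (\<Sum>k\<in>UNIV. \<Sum>l\<in>UNIV. R $ k $ l * W $ l $ k)"
    unfolding trace_def matrix_matrix_mult_def by (simp, subst sum.swap, simp)
  also have "\<dots> = (\<Sum>j\<in>UNIV. \<Sum>k\<in>UNIV. (\<Sum>i\<in>UNIV. P $ i $ j * Z $ j $ i) * (\<Sum>l\<in>UNIV. R $ k $ l * W $ l $ k))"
    by (rule sum_product)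
  also have "\<dots> = (\<Sum>j\<in>UNIV. \<Sum>k\<in>UNIV. \<Sum>i\<in>UNIV. \<Sum>l\<in>UNIV. Z $ j $ i * W $ l $ k * (P $ i $ j * R $ k $ l))"
    unfolding sum_product by (simp add: mult_ac)
  finally show ?thesis by (simp only: PER)
qed

text \<open>If the operator attached to a tensor vanishes, so does every contraction of the tensor
  by two trace functionals.\<close>

lemma sum_trace_contraction:
  fixes P R P' R' :: "'b \<Rightarrow> complex^'n^'n"
  assumes "\<And>X. (\<Sum>a\<in>A. P a ** X ** R a + P' a ** X ** R' a) = 0"
  shows "(\<Sum>a\<in>A. trace (P a ** Z) * trace (R a ** W) + trace (P' a ** Z) * trace (R' a ** W)) = 0"
proof -
  define E :: "'n \<Rightarrow> 'n \<Rightarrow> complex^'n^'n" where "E j k = (\<chi> a b. if a = j \<and> b = k then 1 else 0)" for j k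
  have "(\<Sum>a\<in>A. trace (P a ** Z) * trace (R a ** W) + trace (P' a ** Z) * trace (R' a ** W)) =
    (\<Sum>a\<in>A. \<Sum>j\<in>UNIV. \<Sum>k\<in>UNIV. \<Sum>i\<in>UNIV. \<Sum>l\<in>UNIV.
      Z $ j $ i * W $ l $ k * (P a ** E j k ** R a + P' a ** E j k ** R' a) $ i $ l)"
    unfolding trace_contraction E_def by (simp add: sum.distrib[symmetric] distrib_left)
  also have "\<dots> = (\<Sum>j\<in>UNIV. \<Sum>k\<in>UNIV. \<Sum>i\<in>UNIV. \<Sum>l\<in>UNIV. \<Sum>a\<in>A.
      Z $ j $ i * W $ l $ k * (P a ** E j k ** R a + P' a ** E j k ** R' a) $ i $ l)"
    by (simp only: sum.swap[of _ _ A])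
  also have "\<dots> = (\<Sum>j\<in>UNIV. \<Sum>k\<in>UNIV. \<Sum>i\<in>UNIV. \<Sum>l\<in>UNIV.
      Z $ j $ i * W $ l $ k * (\<Sum>a\<in>A. P a ** E j k ** R a + P' a ** E j k ** R' a) $ i $ l)"
    by (simp only: sum_distrib_left sum_component)
  finally show ?thesis unfolding assms by simp
qed

lemmas matrix_ring = matrix_add_ldistrib matrix_add_rdistrib matrix_sub_ldistrib matrix_sub_rdistrib
  matrix_mul_assoc matrix_sum_ldistrib matrix_sum_rdistrib

context invariant_lie_algebra
begin

lemma equal_norm_imp_UNIV:
  fixes \<phi> :: "'a \<Rightarrow> complex^'n^'n"
  assumes rep: "lie_rep B \<phi>" and inj: "inj \<phi>" and H: "lie_subalgebra B H"
    and Q_trace: "\<And>x y. trace (\<phi> x ** \<phi> y) = - complex_of_real (Q x y)"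
    and norm: "rep_norm1 (tensor_rep \<phi> (dual_rep \<phi>)) H = rep_norm1 (tensor_rep \<phi> (dual_rep \<phi>)) UNIV"
  shows "H = UNIV"
proof -
  define \<psi> where "\<psi> = tensor_rep \<phi> (dual_rep \<phi>)"
  have rep': "lie_rep B \<psi>" unfolding \<psi>_def by (rule lie_rep_tensor_dual[OF rep])
  have \<psi>: "\<psi> x *v mvec X = mvec (\<phi> x ** X - X ** \<phi> x)" for x X
    by (simp add: \<psi>_def tensor_dual_mvec)
  note norm' = norm[folded \<psi>_def]
  obtain A where A: "Q_basis A H" using Q_basis_exists[of H] H unfolding lie_subalgebra_def by blast
  then have AH: "A \<subseteq> H" and fin: "finite A" by (auto simp: Q_basis_def)
  \<comment> \<open>Invariants in the endomorphism representation are commuting matrices, and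
    \<open>H\<close> has the same invariants as the whole algebra.\<close>
  have commutant: "\<phi> y ** X = X ** \<phi> y" if "\<And>x. x \<in> H \<Longrightarrow> \<phi> x ** X = X ** \<phi> x" for X y
  proof -
    have "\<psi> y *v mvec X = 0"
      by (rule invariants_eq[OF rep' H norm']) (simp add: \<psi> that mvec_simps)
    then have "mvec (\<phi> y ** X - X ** \<phi> y) = mvec 0" by (simp only: \<psi> mvec_simps(3))
    then show ?thesis by simp
  qed
  define C where "C = casimir \<phi> A"
  have C: "\<phi> y ** C = C ** \<phi> y" for y
    unfolding C_def by (rule commutant) (rule casimir_commute[OF rep A H])
  define D where "D X = (\<Sum>a\<in>A. \<phi> a ** X ** \<phi> a)" for X
  \<comment> \<open>Squaring the commutator action gives left and right multiplication by
    \<open>C\<close> and twice the mixed operator \<open>D\<close>.\<close>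
  have cas: "casimir \<psi> A *v mvec X = mvec (C ** X + X ** C - (D X + D X))" for X
  proof -
    have "casimir \<psi> A *v mvec X = (\<Sum>a\<in>A. mvec (\<phi> a ** \<phi> a ** X + X ** (\<phi> a ** \<phi> a)
        - (\<phi> a ** X ** \<phi> a + \<phi> a ** X ** \<phi> a)))"
      unfolding casimir_vector \<psi>
      by (intro sum.cong refl arg_cong[of _ _ mvec]) (simp add: matrix_ring)
    also have "\<dots> = mvec (\<Sum>a\<in>A. \<phi> a ** \<phi> a ** X + X ** (\<phi> a ** \<phi> a)
        - (\<phi> a ** X ** \<phi> a + \<phi> a ** X ** \<phi> a))"
      by (simp add: mvec_def vec_eq_iff sum_component)
    also have "\<dots> = mvec (C ** X + X ** C - (D X + D X))"
      by (simp only: sum.distrib sum_subtractf C_def casimir_def D_def matrix_sum_ldistrib matrix_sum_rdistrib)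
    finally show ?thesis .
  qed
  \<comment> \<open>\<open>C\<close> commutes with every \<open>\<phi> y\<close>, so its part of the
    Casimir operator cancels and the commutation statement is left for \<open>D\<close>
    alone.\<close>
  have D: "\<phi> y ** D X - D X ** \<phi> y = D (\<phi> y ** X - X ** \<phi> y)" for X y
  proof -
    define Y where "Y = \<phi> y ** X - X ** \<phi> y"
    have "mvec (C ** Y + Y ** C - (D Y + D Y)) = casimir \<psi> A *v (\<psi> y *v mvec X)"
      by (simp add: \<psi> cas Y_def)
    also have "\<dots> = \<psi> y *v (casimir \<psi> A *v mvec X)"
      by (rule casimir_commutes_with_all[OF rep' H norm' A])
    also have "\<dots> = mvec (\<phi> y ** (C ** X + X ** C - (D X + D X)) - (C ** X + X ** C - (D X + D X)) ** \<phi> y)"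
      by (simp only: \<psi> cas)
    finally have "C ** Y + Y ** C - (D Y + D Y) =
        \<phi> y ** (C ** X + X ** C - (D X + D X)) - (C ** X + X ** C - (D X + D X)) ** \<phi> y"
      by simp
    moreover have "C ** Y + Y ** C = \<phi> y ** (C ** X + X ** C) - (C ** X + X ** C) ** \<phi> y"
      using C[of y] by (simp add: Y_def matrix_ring) (simp add: matrix_mul_assoc[symmetric])
    moreover have "\<phi> y ** (S - (E + E)) - (S - (E + E)) ** \<phi> y =
        (\<phi> y ** S - S ** \<phi> y) - ((\<phi> y ** E - E ** \<phi> y) + (\<phi> y ** E - E ** \<phi> y))" for S E
      by (simp only: matrix_add_ldistrib matrix_add_rdistrib matrix_sub_ldistrib matrix_sub_rdistrib algebra_simps)
    ultimately have "D Y + D Y = (\<phi> y ** D X - D X ** \<phi> y) + (\<phi> y ** D X - D X ** \<phi> y)"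
      by (simp only: diff_left_imp_eq)
    then have "2 *\<^sub>R D Y = 2 *\<^sub>R (\<phi> y ** D X - D X ** \<phi> y)" by (simp only: scaleR_2)
    then show ?thesis by (simp add: Y_def)
  qed
  \<comment> \<open>Commutation of \<open>D\<close> with the action says that \<open>y\<close>
    annihilates the tensor of the basis \<open>A\<close> with itself, written as an operator
    identity in \<open>X\<close>.\<close>
  have tensor: "(\<Sum>a\<in>A. \<phi> (B y a) ** X ** \<phi> a + \<phi> a ** X ** \<phi> (B y a)) = 0" for X y
  proof -
    have "(\<Sum>a\<in>A. \<phi> (B y a) ** X ** \<phi> a + \<phi> a ** X ** \<phi> (B y a)) =
        (\<phi> y ** D X - D X ** \<phi> y) - D (\<phi> y ** X - X ** \<phi> y)"
      unfolding D_def matrix_sum_ldistrib matrix_sum_rdistrib sum_subtractf[symmetric]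
      by (intro sum.cong refl) (simp add: lie_rep_simps(6)[OF rep] matrix_ring)
    then show ?thesis by (simp add: D)
  qed
  \<comment> \<open>Here it matters that \<open>Q\<close> is the trace form of
    \<open>\<phi>\<close>: contracting with \<open>\<phi> z\<close> and \<open>\<phi> w\<close>
    turns traces into values of \<open>Q\<close>.\<close>
  have Q_id: "(\<Sum>a\<in>A. Q (B y a) z * Q a w + Q a z * Q (B y a) w) = 0" for y z w
  proof -
    have "complex_of_real (\<Sum>a\<in>A. Q (B y a) z * Q a w + Q a z * Q (B y a) w) =
        (\<Sum>a\<in>A. trace (\<phi> (B y a) ** \<phi> z) * trace (\<phi> a ** \<phi> w)
          + trace (\<phi> a ** \<phi> z) * trace (\<phi> (B y a) ** \<phi> w))"
      by (simp add: Q_trace)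
    also have "\<dots> = 0" by (rule sum_trace_contraction) (rule tensor)
    finally show ?thesis by (simp only: of_real_eq_0_iff)
  qed
  have subH: "subspace H" using H by (simp add: lie_subalgebra_def)
  \<comment> \<open>In \<open>Q_id\<close>, take for \<open>z\<close> the part \<open>r\<close> of
    the bracket orthogonal to \<open>H\<close> and for \<open>w\<close> the basis vector
    \<open>b\<close>; orthonormality leaves the single term \<open>Q (B y b) r\<close>, the squared
    length of \<open>r\<close>.\<close>
  have ideal_basis: "B y b \<in> H" if b: "b \<in> A" for y b
  proof -
    obtain h where h: "h \<in> H" "\<And>w. w \<in> H \<Longrightarrow> Q (B y b - h) w = 0"
      using Q_projection[OF subH] by blast
    define r where "r = B y b - h"
    have r: "Q a r = 0" if "a \<in> H" for a using h(2)[OF that] Q_sym[of a r] by (simp add: r_def)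
    have "0 = (\<Sum>a\<in>A. Q (B y a) r * Q a b + Q a r * Q (B y a) b)" by (simp only: Q_id)
    also have "\<dots> = (\<Sum>a\<in>A. if a = b then Q (B y b) r else 0)"
      using A b r AH by (intro sum.cong) (auto simp: Q_basis_def)
    finally have "Q (B y b) r = 0" using b fin by simp
    then have "Q r r = 0" using r[OF h(1)] by (simp add: r_def Q_simps)
    then show ?thesis using h(1) by (simp add: Q_eq_0_iff r_def)
  qed
  have ideal: "B y x \<in> H" if "x \<in> H" for x y
  proof -
    have "x = (\<Sum>a\<in>A. Q x a *\<^sub>R a)" using that A unfolding Q_basis_def by blast
    then have "B y x = B y (\<Sum>a\<in>A. Q x a *\<^sub>R a)" by (rule arg_cong)
    also have "\<dots> = (\<Sum>a\<in>A. B y (Q x a *\<^sub>R a))"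
      using B_bilinear by (simp add: bilinear_def linear_sum[of "B y"])
    also have "\<dots> \<in> H" using ideal_basis by (intro subspace_sum subH) (simp add: B_simps subspace_scale subH)
    finally show ?thesis .
  qed
  \<comment> \<open>The part \<open>z\<close> of \<open>v\<close> orthogonal to the ideal
    \<open>H\<close> commutes with \<open>H\<close>; by \<open>commutant\<close> and faithfulness it
    is central, hence zero.\<close>
  have "v \<in> H" for v
  proof -
    obtain h where h: "h \<in> H" "\<And>w. w \<in> H \<Longrightarrow> Q (v - h) w = 0"
      using Q_projection[OF subH] by blast
    define z where "z = v - h"
    have "B x z = 0" if x: "x \<in> H" for x
    proof -
      have "B x w \<in> H" for w using ideal[OF x, of w] B_antisym[of x w] subH by (simp add: subspace_neg)
      then have "Q (B x z) (B x z) = 0" using h(2) by (subst ad_skew) (simp add: z_def)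
      then show ?thesis by (simp add: Q_eq_0_iff)
    qed
    then have "\<phi> x ** \<phi> z = \<phi> z ** \<phi> x" if "x \<in> H" for x
      using lie_rep_simps(5,6)[OF rep] that by (metis eq_iff_diff_eq_0)
    then have "\<phi> y ** \<phi> z = \<phi> z ** \<phi> y" for y by (rule commutant)
    then have "\<phi> (B z y) = \<phi> 0" for y by (simp add: lie_rep_simps[OF rep])
    then have "B z y = 0" for y using inj by (simp only: inj_eq)
    then have "z = 0" by (rule centerless)
    then show ?thesis using h(1) by (simp add: z_def)
  qed
  then show ?thesis by blast
qed

end

subsection \<open>The Killing form and the trace form of a representation\<close>

lemma lin_trace_commute:
  fixes f g :: "'a::euclidean_space \<Rightarrow> 'a"
  assumes "linear f" "linear g" shows "lin_trace (\<lambda>x. f (g x)) = lin_trace (\<lambda>x. g (f x))"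
proof -
  have *: "lin_trace (\<lambda>x. f (g x)) = (\<Sum>b\<in>Basis. \<Sum>c\<in>Basis. (g b \<bullet> c) * (f c \<bullet> b))" if "linear f" for f g :: "'a \<Rightarrow> 'a"
  proof -
    have "f (g b) \<bullet> b = (\<Sum>c\<in>Basis. (g b \<bullet> c) * (f c \<bullet> b))" for b
    proof -
      have "f (g b) = f (\<Sum>c\<in>Basis. (g b \<bullet> c) *\<^sub>R c)" by (simp add: euclidean_representation)
      also have "\<dots> = (\<Sum>c\<in>Basis. (g b \<bullet> c) *\<^sub>R f c)" using that by (simp add: linear_sum linear_scale)
      finally show ?thesis by (simp add: inner_sum_left)
    qed
    then show ?thesis by (simp add: lin_trace_def)
  qed
  show ?thesis unfolding *[OF assms(1)] *[OF assms(2)] by (subst sum.swap) (simp add: mult.commute)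
qed

text \<open>Invariance follows from the Jacobi identity and cyclicity of the trace. A central
  element has zero adjoint action and so would be isotropic for the definite form.\<close>

lemma invariant_lie_algebra_killing:
  assumes "compact_semisimple_lie_algebra B"
  shows "invariant_lie_algebra B (\<lambda>x y. - killing_form B x y)"
proof
  show lie: "lie_algebra B" using assms by (simp add: compact_semisimple_lie_algebra_def)
  then have B: "bilinear B" by (simp add: lie_algebra_def)
  have lin: "linear (B x)" for x using B by (simp add: bilinear_def)
  have lin2: "linear (\<lambda>z. B x (B y z))" for x y
    using linear_compose[OF lin lin, of x y] by (simp add: o_def)
  note s = bilinear_ladd[OF B] bilinear_radd[OF B] bilinear_lmul[OF B] bilinear_rmul[OF B]
  show "bilinear (\<lambda>x y. - killing_form B x y)"
    unfolding bilinear_def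
    by (auto intro!: linearI simp: killing_form_def lin_trace_def s inner_add_left sum.distrib sum_distrib_left)
  show "- killing_form B x y = - killing_form B y x" for x y
    unfolding killing_form_def using lin_trace_commute[OF lin lin] by simp
  show neg: "- killing_form B x x > 0" if "x \<noteq> 0" for x
    using assms that by (simp add: compact_semisimple_lie_algebra_def)
  have self: "B x x = 0" for x using lie by (simp add: lie_algebra_def)
  have anti: "B x y = - B y x" for x y
    using self[of "x + y"] self[of x] self[of y] by (simp add: s eq_neg_iff_add_eq_0 add.commute)
  have jac: "B (B x y) z = B x (B y z) - B y (B x z)" for x y z
  proof -
    have "B x (B y z) + B y (B z x) + B z (B x y) = 0" using lie by (simp add: lie_algebra_def)
    moreover have "B y (B z x) = - B y (B x z)" using anti[of z x] bilinear_rneg[OF B] by simp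
    moreover have "B z (B x y) = - B (B x y) z" by (rule anti)
    ultimately show ?thesis by (simp add: algebra_simps)
  qed
  have diff: "lin_trace (\<lambda>z. f z - g z) = lin_trace f - lin_trace g" for f g :: "'a \<Rightarrow> 'a"
    by (simp add: lin_trace_def inner_diff_left sum_subtractf)
  show "- killing_form B (B x y) z = - killing_form B x (B y z)" for x y z
    unfolding killing_form_def jac bilinear_rsub[OF B] diff
    using lin_trace_commute[OF lin[of y] lin2[of x z]] by simp
  show "x = 0" if "\<And>y. B x y = 0" for x
  proof (rule ccontr)
    assume "x \<noteq> 0"
    then have "- killing_form B x x > 0" by (rule neg)
    then show False by (simp add: killing_form_def that lin_trace_def)
  qed
qed

text \<open>If the trace vanishes, \<open>\<phi> x\<close> is nilpotent; by
  \<open>rep_kernel_square\<close> it is then zero.\<close>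

lemma (in invariant_lie_algebra) trace_square:
  fixes \<phi> :: "'a \<Rightarrow> complex^'n^'n"
  assumes rep: "lie_rep B \<phi>"
  shows "\<exists>t\<ge>0. trace (\<phi> x ** \<phi> x) = - complex_of_real t \<and> (t = 0 \<longrightarrow> \<phi> x = 0)"
proof -
  have "proj_on UNIV = (mat 1 :: complex^'n^'n)" by (rule matrix_eqI) (simp add: proj_on)
  then have "subtrace UNIV (\<phi> x ** \<phi> x) = trace (\<phi> x ** \<phi> x)" by (simp add: subtrace_def)
  moreover obtain t where t: "t \<ge> 0" "subtrace UNIV (\<phi> x ** \<phi> x) = - complex_of_real t"
    "t = 0 \<longrightarrow> (\<exists>k. \<forall>v\<in>UNIV. ((*v) (\<phi> x) ^^ k) v = 0)"
    using subtrace_square_of_imaginary_eigenvalues[of UNIV "\<phi> x"] rep_eigenvalue_imaginary[OF rep]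
    by (auto simp: maps_to_def)
  moreover have "\<phi> x = 0" if t0: "t = 0"
  proof -
    obtain k where k: "((*v) (\<phi> x) ^^ k) v = 0" for v using t(3) t0 by blast
    have "((*v) (\<phi> x) ^^ k) v = 0 \<Longrightarrow> \<phi> x *v v = 0" for v
    proof (induction k)
      case (Suc k)
      show ?case
      proof (cases k)
        case 0
        then show ?thesis using Suc.prems by simp
      next
        case (Suc j)
        then have "\<phi> x *v (\<phi> x *v ((*v) (\<phi> x) ^^ j) v) = 0" using Suc.prems by simp
        from rep_kernel_square[OF rep this] show ?thesis using Suc Suc.IH by simp
      qed
    qed simp
    from this[OF k] show ?thesis by (intro matrix_eqI) simp
  qed
  ultimately show ?thesis by metis
qed

text \<open>Polarization transfers reality from squares to all pairs, and faithfulness turns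
  semidefiniteness into definiteness.\<close>

lemma (in invariant_lie_algebra) trace_form:
  assumes rep: "lie_rep B \<phi>" and inj: "inj \<phi>"
  defines "T \<equiv> \<lambda>x y. - Re (trace (\<phi> x ** \<phi> y))"
  shows "trace (\<phi> x ** \<phi> y) = - complex_of_real (T x y)" and "invariant_lie_algebra B T"
proof -
  have real: "Im (trace (\<phi> x ** \<phi> x)) = 0" for x using trace_square[OF rep, of x] by auto
  have "trace (\<phi> (x + y) ** \<phi> (x + y)) =
      trace (\<phi> x ** \<phi> x) + trace (\<phi> y ** \<phi> y) + 2 * trace (\<phi> x ** \<phi> y)"
    using trace_mul_sym[of "\<phi> x" "\<phi> y"]
    by (simp add: lie_rep_simps[OF rep] matrix_add_ldistrib matrix_add_rdistrib trace_add)
  from arg_cong[OF this, of Im] have "Im (trace (\<phi> x ** \<phi> y)) = 0" by (simp add: real)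
  then show "trace (\<phi> x ** \<phi> y) = - complex_of_real (T x y)" by (simp add: T_def complex_eq_iff)
  have tr_scale: "trace (r *\<^sub>R X) = r *\<^sub>R trace X" for r and X :: "complex^'b^'b"
    by (simp add: trace_def scaleR_sum_right)
  show "invariant_lie_algebra B T"
  proof
    show "lie_algebra B" by (rule lie)
    show "bilinear T"
      unfolding bilinear_def T_def
      by (auto intro!: linearI simp: lie_rep_simps[OF rep] matrix_add_ldistrib matrix_add_rdistrib trace_add
          scaleR_matrix_mult tr_scale)
    show "T x y = T y x" for x y unfolding T_def by (subst trace_mul_sym) simp
    show "T x x > 0" if "x \<noteq> 0" for x
    proof -
      have "\<phi> x \<noteq> 0" using inj that lie_rep_simps(5)[OF rep] by (metis injD)
      then show ?thesis using trace_square[OF rep, of x] by (auto simp: T_def less_le)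
    qed
    show "T (B x y) z = T x (B y z)" for x y z
    proof -
      have "trace (\<phi> y ** \<phi> x ** \<phi> z) = trace (\<phi> x ** \<phi> z ** \<phi> y)"
        using trace_mul_sym[of "\<phi> y" "\<phi> x ** \<phi> z"] by (simp add: matrix_mul_assoc)
      then show ?thesis
        by (simp add: T_def lie_rep_simps(6)[OF rep] matrix_sub_ldistrib matrix_sub_rdistrib trace_sub
            matrix_mul_assoc)
    qed
    show "x = 0" if "\<And>y. B x y = 0" for x using that by (rule centerless)
  qed
qed

theorem theorem7:
  fixes B :: "'a::euclidean_space \<Rightarrow> 'a \<Rightarrow> 'a"
    and H :: "'a set"
    and \<phi> :: "'a \<Rightarrow> complex^'n^'n"
  assumes "compact_semisimple_lie_algebra B"
    and "lie_subalgebra B H"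
    and "lie_rep B \<phi>"
    and "inj \<phi>"
  shows "H = UNIV \<longleftrightarrow>
         rep_norm1 (tensor_rep \<phi> (dual_rep \<phi>)) H = rep_norm1 (tensor_rep \<phi> (dual_rep \<phi>)) UNIV"
proof
  \<comment> \<open>The Killing form comes first, since it is what shows the trace form of
    \<open>\<phi>\<close> to be real and definite; the trace form then serves as the inner product
    of the main argument.\<close>
  interpret K: invariant_lie_algebra B "\<lambda>x y. - killing_form B x y"
    by (rule invariant_lie_algebra_killing[OF assms(1)])
  interpret T: invariant_lie_algebra B "\<lambda>x y. - Re (trace (\<phi> x ** \<phi> y))"
    by (rule K.trace_form(2)[OF assms(3,4)])
  assume "rep_norm1 (tensor_rep \<phi> (dual_rep \<phi>)) H = rep_norm1 (tensor_rep \<phi> (dual_rep \<phi>)) UNIV"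
  then show "H = UNIV"
    by (intro T.equal_norm_imp_UNIV[OF assms(3,4,2) K.trace_form(1)[OF assms(3,4)]])
qed simp

end
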